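(* Let $c>0$ be any constant, $N \in \mathbb{N}$, and let $\{\mathcal{A}_i\}$ be a family of $\frac{\rho}{3}$-replicable, $\frac{\delta}{2}$-correct sub-routines, each using $C \frac{\log^c\frac{1}{\rho}}{\rho}$ expected samples and $V=V(\rho)$ runtime. Let $\mathcal{A}$ be any consistent adaptive $N$-composition $$\mathcal{A}(S_1,\ldots,S_{N};r_1,\ldots,r_{N}) = f_{ag}(\mathcal{A}_1(S_1,r_1),\ldots,\mathcal{A}_N(S_{N},r_{N}))$$ with (suitably chosen) sample cutoff $m=O\left(C \frac{\log^c\frac{1}{\rho}}{\rho^2}\right)$, which runs an $m$-sample $\frac{\delta}{2}$-correct procedure post-cutoff. Then: (1) $\mathcal{A}$ uses at most $O\left(C \frac{N \log^{c} \frac{1}{\rho}}{\rho}\right)$ samples in expectation; (2) $\mathcal{A}$ uses at most $O\left(C \frac{\log^{c} \frac{1}{\rho}}{\rho^2}\right)$ samples in the worst case; (3) $\mathcal{A}$ runs in time at most $O(N V(\rho))$; (4) $\mathcal{A}$ is $(N \delta)$-correct and $(N \rho)$-replicable.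
   Context: A statistical problem consists of a domain, a family $\mathscr{P}$ of distributions over it, a solution space $Y$, and a relation $C(\cdot)$ assigning to each $\mathcal{D}\in\mathscr{P}$ its set of correct solutions; an algorithm is $\delta$-correct if on i.i.d. samples from any $\mathcal{D}\in\mathscr{P}$ it outputs a correct solution with probability at least $1-\delta$. Replicability: an algorithm $\mathcal{A}$ with internal randomness $r$ is $\rho$-replicable if for all input distributions $\mathcal{D}$, $\Pr_{r,S,S'}(\mathcal{A}(S;r)=\mathcal{A}(S';r))\ge 1-\rho$, where $S,S'$ are independent sets of i.i.d. samples from $\mathcal{D}$ and $r$ is shared between the two runs. Adaptive $N$-composition: given a family of randomized sub-routines $\{\mathcal{A}_i:(\mathcal{X}_i^*,R)\to Y_i\}$, a randomized algorithm $\mathcal{A}:(\mathcal{X}^*,R)\to Y$ is an adaptive $N$-composition if for every round $i\in[N]$: (i) it draws a fresh sample/random-string pair $(S_i,r_i)$; (ii) it runs a sub-routine $\mathcal{A}_{j_i}(S_i,r_i)$; (iii) it chooses (based on the outputs so far) the sub-routine $\mathcal{A}_{j_{i+1}}$ for the next round ($\mathcal{A}_{j_1}$ may be any sub-routine). After these rounds it applies an arbitrary aggregation function $f_{ag}$ to the transcript of outputs; in the displayed formula $\mathcal{A}_i$ denotes the sub-routine run in round $i$. The algorithm may have a sample cutoff $m$: if the total number of samples would exceed $m$ it abandons the composition and runs a separate procedure. $\mathcal{A}$ is consistent if, when $\mathcal{A}$ and its sub-routines each solve a statistical problem, $f_{ag}$ outputs a correct solution whenever all its inputs are correct solutions. $C$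 is a parameter of the sub-routines' sample complexity. The cost of computing $f_{ag}$ is taken to be negligible compared to the sub-routines' running time.
   Formalization: Claim (3) is false if the post-cutoff procedure may be arbitrarily slow; it is proved assuming that procedure runs in O(NV) worst-case time, or O(V/ρ) expected time for an expected bound, with choosing the next sub-routine and f_ag taken as free of cost. *)

theory Defs
  imports "HOL-Probability.Probability"
begin

section \<open>Statistical problems\<close>

record ('x, 'y) problem =
  dom_space :: "'x measure"
  dists :: "'x measure set"
  sol_space :: "'y measure"
  correct_sols :: "'x measure \<Rightarrow> 'y set"

text \<open>Of \<open>dom_space\<close> and \<open>sol_space\<close> only the underlying measurable space matters.\<close>

definition distributions_on :: "'x measure \<Rightarrow> 'x measure set" where
  "distributions_on X = {D. prob_space D \<and> sets D = sets X}"

text \<open>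
  The last two conjuncts make the events "the output is correct" and "two outputs agree"
  measurable. The diagonal is measurable in every second countable Hausdorff space
  with its Borel sets and in every countable discrete space.
\<close>

definition statistical_problem :: "('x, 'y) problem \<Rightarrow> bool" where
  "statistical_problem Q \<longleftrightarrow>
     dists Q \<subseteq> distributions_on (dom_space Q) \<and>
     (\<forall>D\<in>dists Q. correct_sols Q D \<in> sets (sol_space Q)) \<and>
     {p \<in> space (sol_space Q \<Otimes>\<^sub>M sol_space Q). fst p = snd p}
       \<in> sets (sol_space Q \<Otimes>\<^sub>M sol_space Q)"

section \<open>Randomized algorithms with sample access\<close>

text \<open>
  An algorithm is described by its observable behaviour on a sample source of type \<open>'s\<close> and an
  internal random string of type \<open>'r\<close>: its output, the number of samples it reads
  (\<open>\<infinity>\<close> if it never stops reading) and its running time. For a basic algorithm the source is an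
  infinite sequence, of which only a finite, possibly data-dependent, prefix is read; a composition
  is fed one such sequence per round.
\<close>

record ('s, 'r, 'y) algo =
  result :: "'s \<Rightarrow> 'r \<Rightarrow> 'y"
  samples :: "'s \<Rightarrow> 'r \<Rightarrow> enat"
  runtime :: "'s \<Rightarrow> 'r \<Rightarrow> ennreal"

definition iid_stream :: "'x measure \<Rightarrow> (nat \<Rightarrow> 'x) measure" where
  "iid_stream D = (\<Pi>\<^sub>M k\<in>UNIV. D)"

text \<open>Streams \<open>0, \<dots>, N - 1\<close> feed the rounds, stream \<open>N\<close> feeds the post-cutoff procedure;
  likewise for random strings.\<close>

definition iid_rounds :: "nat \<Rightarrow> 'x measure \<Rightarrow> (nat \<Rightarrow> nat \<Rightarrow> 'x) measure" where
  "iid_rounds N D = (\<Pi>\<^sub>M i\<in>{..N}. iid_stream D)"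

definition round_strings :: "nat \<Rightarrow> 'r measure \<Rightarrow> (nat \<Rightarrow> 'r) measure" where
  "round_strings N R = (\<Pi>\<^sub>M i\<in>{..N}. R)"

text \<open>The last conjunct says that \<open>samples\<close> really counts the samples read: the behaviour on
  \<open>S\<close> is determined by the first \<open>samples A S r\<close> entries of \<open>S\<close>.\<close>

definition algorithm ::
    "'x measure \<Rightarrow> 'r measure \<Rightarrow> 'y measure \<Rightarrow> (nat \<Rightarrow> 'x, 'r, 'y) algo \<Rightarrow> bool" where
  "algorithm X R Y A \<longleftrightarrow>
     (\<lambda>(S, r). result A S r) \<in> iid_stream X \<Otimes>\<^sub>M R \<rightarrow>\<^sub>M Y \<and>
     (\<lambda>(S, r). samples A S r) \<in> iid_stream X \<Otimes>\<^sub>M R \<rightarrow>\<^sub>M count_space UNIV \<and>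
     (\<lambda>(S, r). runtime A S r) \<in> iid_stream X \<Otimes>\<^sub>M R \<rightarrow>\<^sub>M borel \<and>
     (\<forall>S\<in>space (iid_stream X). \<forall>S'\<in>space (iid_stream X). \<forall>r\<in>space R.
        (\<forall>k. enat k < samples A S r \<longrightarrow> S k = S' k) \<longrightarrow>
        result A S' r = result A S r \<and> samples A S' r = samples A S r \<and>
        runtime A S' r = runtime A S r)"

text \<open>
  In the following, \<open>law D\<close> is the distribution of the sample source when samples are drawn i.i.d.
  from \<open>D\<close> (\<open>iid_stream\<close> or \<open>iid_rounds N\<close>), and \<open>R\<close> is the distribution of the random string.
  Correctness is only required for the distributions of the problem; replicability and resource
  bounds refer to all distributions over the domain \<open>X\<close>.
\<close>

definition delta_correct ::
    "('x measure \<Rightarrow> 's measure) \<Rightarrow> 'r measure \<Rightarrow> ('x, 'y) problem \<Rightarrow> real \<Rightarrow>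
     ('s, 'r, 'y) algo \<Rightarrow> bool" where
  "delta_correct law R Q \<delta> A \<longleftrightarrow>
     (\<forall>D\<in>dists Q.
        measure (law D \<Otimes>\<^sub>M R)
          {(S, r) \<in> space (law D \<Otimes>\<^sub>M R). result A S r \<in> correct_sols Q D} \<ge> 1 - \<delta>)"

definition replicable ::
    "('x measure \<Rightarrow> 's measure) \<Rightarrow> 'r measure \<Rightarrow> 'x measure \<Rightarrow> real \<Rightarrow>
     ('s, 'r, 'y) algo \<Rightarrow> bool" where
  "replicable law R X \<rho> A \<longleftrightarrow>
     (\<forall>D\<in>distributions_on X.
        measure (R \<Otimes>\<^sub>M (law D \<Otimes>\<^sub>M law D))
          {(r, S, S') \<in> space (R \<Otimes>\<^sub>M (law D \<Otimes>\<^sub>M law D)). result A S r = result A S' r}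
        \<ge> 1 - \<rho>)"

definition expected_samples_le ::
    "('x measure \<Rightarrow> 's measure) \<Rightarrow> 'r measure \<Rightarrow> 'x measure \<Rightarrow> real \<Rightarrow>
     ('s, 'r, 'y) algo \<Rightarrow> bool" where
  "expected_samples_le law R X b A \<longleftrightarrow>
     (\<forall>D\<in>distributions_on X.
        (\<integral>\<^sup>+ (S, r). ennreal_of_enat (samples A S r) \<partial>(law D \<Otimes>\<^sub>M R)) \<le> ennreal b)"

definition worst_case_samples_le ::
    "('x measure \<Rightarrow> 's measure) \<Rightarrow> 'r measure \<Rightarrow> 'x measure \<Rightarrow> real \<Rightarrow>
     ('s, 'r, 'y) algo \<Rightarrow> bool" where
  "worst_case_samples_le law R X b A \<longleftrightarrow>
     (\<forall>S\<in>space (law X). \<forall>r\<in>space R. ennreal_of_enat (samples A S r) \<le> ennreal b)"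

definition expected_runtime_le ::
    "('x measure \<Rightarrow> 's measure) \<Rightarrow> 'r measure \<Rightarrow> 'x measure \<Rightarrow> real \<Rightarrow>
     ('s, 'r, 'y) algo \<Rightarrow> bool" where
  "expected_runtime_le law R X b A \<longleftrightarrow>
     (\<forall>D\<in>distributions_on X.
        (\<integral>\<^sup>+ (S, r). runtime A S r \<partial>(law D \<Otimes>\<^sub>M R)) \<le> ennreal b)"

definition worst_case_runtime_le ::
    "('x measure \<Rightarrow> 's measure) \<Rightarrow> 'r measure \<Rightarrow> 'x measure \<Rightarrow> real \<Rightarrow>
     ('s, 'r, 'y) algo \<Rightarrow> bool" where
  "worst_case_runtime_le law R X b A \<longleftrightarrow>
     (\<forall>S\<in>space (law X). \<forall>r\<in>space R. runtime A S r \<le> ennreal b)"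

section \<open>Adaptive composition\<close>

text \<open>
  \<open>subroutine j\<close> works over its own domain; \<open>proj j\<close> turns one sample of the composition into one
  sample for \<open>subroutine j\<close> (the identity if the domains coincide, a coordinate projection if the
  composition samples from a product). \<open>next_sub ys\<close> is the index of the sub-routine run after the
  outputs \<open>ys\<close>, \<open>aggregate\<close> is the aggregation function and \<open>post_cutoff\<close> the procedure run once
  the sample cutoff has been hit.
\<close>

record ('x, 'z, 'r, 'y, 'j, 'w) composition =
  subroutine :: "'j \<Rightarrow> (nat \<Rightarrow> 'z, 'r, 'y) algo"
  proj :: "'j \<Rightarrow> 'x \<Rightarrow> 'z"
  next_sub :: "'y list \<Rightarrow> 'j"
  aggregate :: "'y list \<Rightarrow> 'w"
  post_cutoff :: "(nat \<Rightarrow> 'x, 'r, 'w) algo"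

primrec transcript ::
    "('x, 'z, 'r, 'y, 'j, 'w) composition \<Rightarrow> (nat \<Rightarrow> nat \<Rightarrow> 'x) \<Rightarrow> (nat \<Rightarrow> 'r) \<Rightarrow> nat \<Rightarrow> 'y list"
  where
    "transcript A S r 0 = []"
  | "transcript A S r (Suc i) =
       (let ys = transcript A S r i; j = next_sub A ys
        in ys @ [result (subroutine A j) (proj A j \<circ> S i) (r i)])"

definition round_index ::
    "('x, 'z, 'r, 'y, 'j, 'w) composition \<Rightarrow> (nat \<Rightarrow> nat \<Rightarrow> 'x) \<Rightarrow> (nat \<Rightarrow> 'r) \<Rightarrow> nat \<Rightarrow> 'j" where
  "round_index A S r i = next_sub A (transcript A S r i)"

definition round_samples ::
    "('x, 'z, 'r, 'y, 'j, 'w) composition \<Rightarrow> (nat \<Rightarrow> nat \<Rightarrow> 'x) \<Rightarrow> (nat \<Rightarrow> 'r) \<Rightarrow> nat \<Rightarrow> enat" where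
  "round_samples A S r i =
     (let j = round_index A S r i in samples (subroutine A j) (proj A j \<circ> S i) (r i))"

definition round_runtime ::
    "('x, 'z, 'r, 'y, 'j, 'w) composition \<Rightarrow> (nat \<Rightarrow> nat \<Rightarrow> 'x) \<Rightarrow> (nat \<Rightarrow> 'r) \<Rightarrow> nat \<Rightarrow> ennreal"
  where
  "round_runtime A S r i =
     (let j = round_index A S r i in runtime (subroutine A j) (proj A j \<circ> S i) (r i))"

definition samples_before ::
    "('x, 'z, 'r, 'y, 'j, 'w) composition \<Rightarrow> (nat \<Rightarrow> nat \<Rightarrow> 'x) \<Rightarrow> (nat \<Rightarrow> 'r) \<Rightarrow> nat \<Rightarrow> enat" where
  "samples_before A S r n = (\<Sum>i<n. round_samples A S r i)"

definition cut_off ::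
    "nat \<Rightarrow> nat \<Rightarrow> ('x, 'z, 'r, 'y, 'j, 'w) composition \<Rightarrow> (nat \<Rightarrow> nat \<Rightarrow> 'x) \<Rightarrow> (nat \<Rightarrow> 'r) \<Rightarrow> bool"
  where
  "cut_off N m A S r \<longleftrightarrow> enat m < samples_before A S r N"

text \<open>
  The \<open>N\<close>-composition with sample cutoff \<open>m\<close>. When the run is cut off, \<open>m\<close> samples have been read by
  the sub-routines (the request for sample \<open>m + 1\<close> is refused). The round in which this happens is
  charged its full running time; later rounds are not started. Choosing the next sub-routine and
  aggregating are free of cost.
\<close>

definition composed_algo ::
    "nat \<Rightarrow> nat \<Rightarrow> ('x, 'z, 'r, 'y, 'j, 'w) composition \<Rightarrow>
     (nat \<Rightarrow> nat \<Rightarrow> 'x, nat \<Rightarrow> 'r, 'w) algo" where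
  "composed_algo N m A =
     \<lparr>result = (\<lambda>S r.
        if cut_off N m A S r then result (post_cutoff A) (S N) (r N)
        else aggregate A (transcript A S r N)),
      samples = (\<lambda>S r.
        if cut_off N m A S r then enat m + samples (post_cutoff A) (S N) (r N)
        else samples_before A S r N),
      runtime = (\<lambda>S r.
        (\<Sum>i | i < N \<and> samples_before A S r i \<le> enat m. round_runtime A S r i) +
        (if cut_off N m A S r then runtime (post_cutoff A) (S N) (r N) else 0))\<rparr>"

text \<open>
  \<open>Q j\<close> is the problem addressed by \<open>subroutine j\<close>, and \<open>QA\<close> the one addressed by the composition.
  The last two conjuncts say that the quantities of the composition are random variables. They hold
  automatically if there are countably many sub-routines and \<open>next_sub\<close> and \<open>aggregate\<close> are measurable.
\<close>

definition adaptive_composition ::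
    "nat \<Rightarrow> 'r measure \<Rightarrow> ('j \<Rightarrow> ('z, 'y) problem) \<Rightarrow> ('x, 'w) problem \<Rightarrow>
     ('x, 'z, 'r, 'y, 'j, 'w) composition \<Rightarrow> bool" where
  "adaptive_composition N R Q QA A \<longleftrightarrow>
     prob_space R \<and>
     (\<forall>j. statistical_problem (Q j) \<and>
          algorithm (dom_space (Q j)) R (sol_space (Q j)) (subroutine A j) \<and>
          proj A j \<in> dom_space QA \<rightarrow>\<^sub>M dom_space (Q j)) \<and>
     statistical_problem QA \<and>
     algorithm (dom_space QA) R (sol_space QA) (post_cutoff A) \<and>
     (\<forall>i<N.
        (\<lambda>(S, r). round_samples A S r i)
          \<in> iid_rounds N (dom_space QA) \<Otimes>\<^sub>M round_strings N R \<rightarrow>\<^sub>M count_space UNIV \<and>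
        (\<lambda>(S, r). round_runtime A S r i)
          \<in> iid_rounds N (dom_space QA) \<Otimes>\<^sub>M round_strings N R \<rightarrow>\<^sub>M borel) \<and>
     (\<lambda>(S, r). aggregate A (transcript A S r N))
       \<in> iid_rounds N (dom_space QA) \<Otimes>\<^sub>M round_strings N R \<rightarrow>\<^sub>M sol_space QA"

definition sub_dist ::
    "('j \<Rightarrow> ('z, 'y) problem) \<Rightarrow> ('x, 'z, 'r, 'y, 'j, 'w) composition \<Rightarrow> 'j \<Rightarrow>
     'x measure \<Rightarrow> 'z measure" where
  "sub_dist Q A j D = distr D (dom_space (Q j)) (proj A j)"

text \<open>The sub-routines are only ever called on inputs satisfying the promise of their problem, and
  correct sub-solutions are aggregated to a correct solution.\<close>

definition consistent ::
    "nat \<Rightarrow> ('j \<Rightarrow> ('z, 'y) problem) \<Rightarrow> ('x, 'w) problem \<Rightarrow>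
     ('x, 'z, 'r, 'y, 'j, 'w) composition \<Rightarrow> bool" where
  "consistent N Q QA A \<longleftrightarrow>
     (\<forall>D\<in>dists QA.
        (\<forall>j. sub_dist Q A j D \<in> dists (Q j)) \<and>
        (\<forall>ys. length ys = N \<and>
           (\<forall>i<N. let j = next_sub A (take i ys)
                  in ys ! i \<in> correct_sols (Q j) (sub_dist Q A j D)) \<longrightarrow>
           aggregate A ys \<in> correct_sols QA D))"

end

theory Submission
  imports Defs
begin

text \<open>
  Choose the cutoff \<open>m = \<lfloor>3 E / \<rho>\<rfloor>\<close>, where \<open>E\<close> is the expected sample size of one sub-routine. A fresh round
  is independent of the history, so \<open>N\<close> rounds use at most \<open>N E\<close> samples in expectation and, by
  Markov's inequality, the cutoff is hit with probability at most \<open>N \<rho> / 3\<close>. Two runs sharing their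
  random strings can only disagree if one of them is cut off or their aggregates differ, and the
  transcripts diverge with probability at most \<open>N \<rho> / 3\<close> by a union bound over the rounds; correctness
  is the same union bound with the post-cutoff procedure as one more event.

  The union bound needs care, since the set of runs that go wrong in round \<open>k\<close> need not be measurable:
  the sub-routine run there depends on the history in an arbitrary way. It is therefore carried out
  pointwise, redrawing one round at a time while the history is held fixed.
\<close>

section \<open>Redrawing a component and the sequential union bound\<close>

text \<open>The cutoff is fixed before \<open>N\<close> is known. This is possible because Markov's
  bound and the permitted error \<open>N * \<rho>\<close> both grow linearly in \<open>N\<close>.
  Truncation never enters the analysis of a round: \<open>transcript\<close> and
  \<open>round_samples\<close> describe all \<open>N\<close> rounds, whether or not the run is cut
  off, and the cutoff is one event of this untruncated run. Adaptivity is the obstacle. The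
  sub-routine of a round is an arbitrary function of the history, so neither conditioning on the
  history nor summing over the possible sub-routines is available. Independence is therefore
  expressed by \<open>resampling\<close>: with the history fixed as a point, the sub-routine is
  fixed too and only its own guarantee is needed. The same notion serves a single run (streams and
  strings) and a pair of runs (one string, two streams). The samples read after a cutoff are charged
  to those requested before it, which already exceed \<open>m\<close>. The post-cutoff procedure has
  a component of its own, with index \<open>N\<close>, so its expected running time gets multiplied
  by the cutoff probability; this absorbs a factor \<open>1 / \<rho>\<close>.\<close>

text \<open>\<open>u w x\<close> is the outcome \<open>w\<close> with one of its components replaced by the fresh draw \<open>x\<close>.\<close>

definition resampling :: "'a measure \<Rightarrow> 'b measure \<Rightarrow> ('a \<Rightarrow> 'b \<Rightarrow> 'a) \<Rightarrow> bool" where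
  "resampling M P u \<longleftrightarrow>
     (\<lambda>(w, x). u w x) \<in> M \<Otimes>\<^sub>M P \<rightarrow>\<^sub>M M \<and>
     (\<forall>f\<in>borel_measurable M. (\<integral>\<^sup>+ w. \<integral>\<^sup>+ x. f (u w x) \<partial>P \<partial>M) = (\<integral>\<^sup>+ w. f w \<partial>M))"

lemma resampling_measurable:
  assumes "resampling M P u"
  shows "(\<lambda>(w, x). u w x) \<in> M \<Otimes>\<^sub>M P \<rightarrow>\<^sub>M M"
  using assms by (simp add: resampling_def)

lemma resampling_nn_integral:
  assumes "resampling M P u" "f \<in> borel_measurable M"
  shows "(\<integral>\<^sup>+ w. \<integral>\<^sup>+ x. f (u w x) \<partial>P \<partial>M) = (\<integral>\<^sup>+ w. f w \<partial>M)"
  using assms by (simp add: resampling_def)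

text \<open>The form in which independence is mostly used: a bound on the fresh draw, valid for each
  fixed outcome \<open>w\<close>, integrates to a bound on \<open>f\<close>. The bound
  \<open>g\<close> may depend on \<open>w\<close> in any way, since monotonicity of the integral
  asks for no measurability.\<close>

lemma resampling_nn_integral_le:
  assumes "resampling M P u" "f \<in> borel_measurable M"
    and "\<And>w. w \<in> space M \<Longrightarrow> (\<integral>\<^sup>+ x. f (u w x) \<partial>P) \<le> g w"
  shows "(\<integral>\<^sup>+ w. f w \<partial>M) \<le> (\<integral>\<^sup>+ w. g w \<partial>M)"
  using assms(3) by (subst resampling_nn_integral[OF assms(1,2), symmetric]) (rule nn_integral_mono)

text \<open>Fubini lets the two factors be redrawn one after the other. Runs are nested pairs of
  product measures, so with \<open>resampling_PiM\<close> this covers all laws that occur.\<close>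

lemma resampling_pair:
  assumes "prob_space M" "prob_space P" "prob_space M'" "prob_space P'"
    and u: "resampling M P u" and u': "resampling M' P' u'"
  shows "resampling (M \<Otimes>\<^sub>M M') (P \<Otimes>\<^sub>M P') (\<lambda>w x. (u (fst w) (fst x), u' (snd w) (snd x)))"
proof -
  interpret M: prob_space M by fact
  interpret P: prob_space P by fact
  interpret M': prob_space M' by fact
  interpret P': prob_space P' by fact
  interpret M'P: pair_sigma_finite M' P ..
  have m: "(\<lambda>w. u (f w) (g w)) \<in> N \<rightarrow>\<^sub>M M"
    if "f \<in> N \<rightarrow>\<^sub>M M" "g \<in> N \<rightarrow>\<^sub>M P" for f g and N :: "'z measure"
    using measurable_compose[OF measurable_Pair[OF that] resampling_measurable[OF u]] by simp
  have m': "(\<lambda>w. u' (f w) (g w)) \<in> N \<rightarrow>\<^sub>M M'"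
    if "f \<in> N \<rightarrow>\<^sub>M M'" "g \<in> N \<rightarrow>\<^sub>M P'" for f g and N :: "'z measure"
    using measurable_compose[OF measurable_Pair[OF that] resampling_measurable[OF u']] by simp
  show ?thesis
    unfolding resampling_def
  proof (intro conjI ballI)
    show "(\<lambda>(w, x). (u (fst w) (fst x), u' (snd w) (snd x)))
        \<in> (M \<Otimes>\<^sub>M M') \<Otimes>\<^sub>M (P \<Otimes>\<^sub>M P') \<rightarrow>\<^sub>M M \<Otimes>\<^sub>M M'"
      unfolding split_beta by (intro measurable_Pair m m'; measurable)
  next
    fix f :: "_ \<Rightarrow> ennreal"
    assume f[measurable]: "f \<in> borel_measurable (M \<Otimes>\<^sub>M M')"
    have fm: "(\<lambda>z. f (a z, b z)) \<in> borel_measurable N"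
      if "a \<in> N \<rightarrow>\<^sub>M M" "b \<in> N \<rightarrow>\<^sub>M M'" for a b and N :: "'z measure"
      using measurable_compose[OF measurable_Pair[OF that] f] .
    have inner: "(\<lambda>w. \<integral>\<^sup>+ x. \<integral>\<^sup>+ x'. f (u (fst w) x, u' (snd w) x') \<partial>P' \<partial>P)
        \<in> borel_measurable (M \<Otimes>\<^sub>M M')"
      by (rule P.borel_measurable_nn_integral, unfold split_beta,
          rule P'.borel_measurable_nn_integral, unfold split_beta, intro fm m m'; measurable)
    have "(\<integral>\<^sup>+ w. \<integral>\<^sup>+ x. f (u (fst w) (fst x), u' (snd w) (snd x)) \<partial>(P \<Otimes>\<^sub>M P') \<partial>(M \<Otimes>\<^sub>M M')) =
      (\<integral>\<^sup>+ w. \<integral>\<^sup>+ x. \<integral>\<^sup>+ x'. f (u (fst w) x, u' (snd w) x') \<partial>P' \<partial>P \<partial>(M \<Otimes>\<^sub>M M'))"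
      by (intro nn_integral_cong, subst P'.nn_integral_fst[symmetric])
        (auto intro!: fm m m' simp: space_pair_measure)
    also have "\<dots> = (\<integral>\<^sup>+ w. \<integral>\<^sup>+ w'. \<integral>\<^sup>+ x. \<integral>\<^sup>+ x'. f (u w x, u' w' x') \<partial>P' \<partial>P \<partial>M' \<partial>M)"
      using M'.nn_integral_fst[OF inner] by simp
    \<comment> \<open>Exchanging \<open>w'\<close> with \<open>x\<close> places each component next
      to its own fresh draw, after which \<open>u'\<close> and then \<open>u\<close> can be
      absorbed.\<close>
    also have "\<dots> = (\<integral>\<^sup>+ w. \<integral>\<^sup>+ x. \<integral>\<^sup>+ w'. \<integral>\<^sup>+ x'. f (u w x, u' w' x') \<partial>P' \<partial>M' \<partial>P \<partial>M)"
      by (intro nn_integral_cong M'P.Fubini'[symmetric], unfold split_beta,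
          rule P'.borel_measurable_nn_integral, unfold split_beta, intro fm m m'; measurable)
    also have "\<dots> = (\<integral>\<^sup>+ w. \<integral>\<^sup>+ x. \<integral>\<^sup>+ w'. f (u w x, w') \<partial>M' \<partial>P \<partial>M)"
      by (intro nn_integral_cong resampling_nn_integral[OF u', where f = "\<lambda>w'. f (_, w')"])
        (auto intro!: fm m)
    also have "\<dots> = (\<integral>\<^sup>+ w. \<integral>\<^sup>+ w'. f (w, w') \<partial>M' \<partial>M)"
      by (intro resampling_nn_integral[OF u, where f = "\<lambda>w. \<integral>\<^sup>+ w'. f (w, w') \<partial>M'"])
        auto
    also have "\<dots> = (\<integral>\<^sup>+ w. f w \<partial>(M \<Otimes>\<^sub>M M'))"
      by (rule M'.nn_integral_fst) simp
    finally show "(\<integral>\<^sup>+ w. \<integral>\<^sup>+ x. f (u (fst w) (fst x), u' (snd w) (snd x)) \<partial>(P \<Otimes>\<^sub>M P') \<partial>(M \<Otimes>\<^sub>M M'))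
      = (\<integral>\<^sup>+ w. f w \<partial>(M \<Otimes>\<^sub>M M'))" .
  qed
qed

text \<open>Component \<open>i\<close> is split off by \<open>product_nn_integral_insert\<close>;
  its old value is overwritten and integrates out to \<open>1\<close>, leaving the fresh value in
  its place.\<close>

lemma resampling_PiM:
  assumes "prob_space P" "finite I" "i \<in> I"
  shows "resampling (\<Pi>\<^sub>M i\<in>I. P) P (\<lambda>w x. w(i := x))"
proof -
  interpret P: prob_space P by fact
  interpret product_sigma_finite "\<lambda>_. P" ..
  define J where "J = I - {i}"
  have J: "finite J" "i \<notin> J" "I = insert i J"
    using assms by (auto simp: J_def)
  have upd: "(\<lambda>(w, x). w(i := x)) \<in> (\<Pi>\<^sub>M i\<in>K. P) \<Otimes>\<^sub>M P \<rightarrow>\<^sub>M (\<Pi>\<^sub>M i\<in>I. P)"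
    if "insert i K = I" for K
    using measurable_add_dim[of i K "\<lambda>_. P"] that by simp
  show ?thesis
    unfolding resampling_def
  proof (intro conjI ballI)
    show "(\<lambda>(w, x). w(i := x)) \<in> (\<Pi>\<^sub>M i\<in>I. P) \<Otimes>\<^sub>M P \<rightarrow>\<^sub>M (\<Pi>\<^sub>M i\<in>I. P)"
      using assms by (intro upd) auto
  next
    fix f :: "_ \<Rightarrow> ennreal"
    assume f[measurable]: "f \<in> borel_measurable (\<Pi>\<^sub>M i\<in>I. P)"
    have "(\<lambda>w. \<integral>\<^sup>+ x. f (w(i := x)) \<partial>P) \<in> borel_measurable (\<Pi>\<^sub>M i\<in>I. P)"
      using measurable_compose[OF upd f] assms(3)
      by (intro P.borel_measurable_nn_integral) (auto simp: split_beta insert_absorb)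
    then have "(\<integral>\<^sup>+ w. \<integral>\<^sup>+ x. f (w(i := x)) \<partial>P \<partial>(\<Pi>\<^sub>M i\<in>I. P)) =
      (\<integral>\<^sup>+ w. \<integral>\<^sup>+ x'. \<integral>\<^sup>+ x. f ((w(i := x'))(i := x)) \<partial>P \<partial>P \<partial>(\<Pi>\<^sub>M i\<in>J. P))"
      unfolding J(3) by (subst product_nn_integral_insert[OF J(1,2)]) auto
    also have "\<dots> = (\<integral>\<^sup>+ w. \<integral>\<^sup>+ x. f (w(i := x)) \<partial>P \<partial>(\<Pi>\<^sub>M i\<in>J. P))"
      by (simp add: P.emeasure_space_1)
    also have "\<dots> = (\<integral>\<^sup>+ w. f w \<partial>(\<Pi>\<^sub>M i\<in>I. P))"
      using f unfolding J(3) by (subst product_nn_integral_insert[OF J(1,2)]) auto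
    finally show "(\<integral>\<^sup>+ w. \<integral>\<^sup>+ x. f (w(i := x)) \<partial>P \<partial>(\<Pi>\<^sub>M i\<in>I. P)) = (\<integral>\<^sup>+ w. f w \<partial>(\<Pi>\<^sub>M i\<in>I. P))" .
  qed
qed

text \<open>
  \<open>G k\<close> says that nothing has gone wrong in the first \<open>k\<close> rounds; it need not be measurable. The proof
  redraws rounds \<open>n - 1, \<dots>, 0\<close> of the indicator of \<open>F\<close> in turn: after \<open>d\<close> of them, the conditional
  probability \<open>f\<close> of \<open>F\<close> is at most \<open>d * b\<close> wherever \<open>G (n - d)\<close> holds.
\<close>

lemma sequential_union_bound:
  fixes b :: ennreal
  assumes P: "prob_space P"
    and u: "\<And>k. k < n \<Longrightarrow> resampling M P (u k)"
    and F: "F \<in> sets M"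
    and start: "\<And>w. w \<in> space M \<Longrightarrow> G 0 w"
    and step: "\<And>k w. \<lbrakk>k < n; w \<in> space M; G k w\<rbrakk> \<Longrightarrow>
      \<exists>B\<in>sets P. emeasure P B \<le> b \<and> (\<forall>x\<in>space P - B. G (Suc k) (u k w x))"
    and final: "\<And>w. \<lbrakk>w \<in> F; G n w\<rbrakk> \<Longrightarrow> False"
    and M: "prob_space M"
  shows "emeasure M F \<le> of_nat n * b"
proof -
  interpret P: prob_space P by fact
  interpret M: prob_space M by fact
  \<comment> \<open>\<open>G\<close> restricts only the points at which \<open>f\<close> is bounded
    and never occurs under an integral. The bound \<open>f w \<le> 1\<close> is kept because it is
    all that is known on the bad set of a round.\<close>
  have "\<exists>f\<in>borel_measurable M. (\<forall>w\<in>space M. f w \<le> 1) \<and> emeasure M F \<le> (\<integral>\<^sup>+ w. f w \<partial>M) \<and>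
      (\<forall>w\<in>space M. G (n - d) w \<longrightarrow> f w \<le> of_nat d * b)" if "d \<le> n" for d
    using that
  proof (induction d)
    case 0
    show ?case
      using F final by (intro bexI[of _ "indicator F"]) (auto split: split_indicator)
  next
    case (Suc d)
    then obtain f where f[measurable]: "f \<in> borel_measurable M"
      and f1: "\<And>w. w \<in> space M \<Longrightarrow> f w \<le> 1"
      and fF: "emeasure M F \<le> (\<integral>\<^sup>+ w. f w \<partial>M)"
      and fG: "\<And>w. \<lbrakk>w \<in> space M; G (n - d) w\<rbrakk> \<Longrightarrow> f w \<le> of_nat d * b"
      by auto
    define k where "k = n - Suc d"
    have k: "k < n" "Suc k = n - d"
      using Suc.prems by (auto simp: k_def)
    note um = resampling_measurable[OF u[OF k(1)]]
    have uM: "u k w x \<in> space M" if "w \<in> space M" "x \<in> space P" for w x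
      using measurable_space[OF um, of "(w, x)"] that by (simp add: space_pair_measure)
    show ?case
    proof (intro bexI[of _ "\<lambda>w. \<integral>\<^sup>+ x. f (u k w x) \<partial>P"] conjI ballI impI)
      show "(\<lambda>w. \<integral>\<^sup>+ x. f (u k w x) \<partial>P) \<in> borel_measurable M"
        using measurable_compose[OF um f]
        by (intro P.borel_measurable_nn_integral) (simp add: split_beta)
      show "emeasure M F \<le> (\<integral>\<^sup>+ w. \<integral>\<^sup>+ x. f (u k w x) \<partial>P \<partial>M)"
        using fF by (simp add: resampling_nn_integral[OF u[OF k(1)]])
      fix w assume w: "w \<in> space M"
      have "(\<integral>\<^sup>+ x. f (u k w x) \<partial>P) \<le> (\<integral>\<^sup>+ x. 1 \<partial>P)"
        by (intro nn_integral_mono f1 uM w)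
      then show "(\<integral>\<^sup>+ x. f (u k w x) \<partial>P) \<le> 1"
        by (simp add: P.emeasure_space_1)
      assume "G (n - Suc d) w"
      then obtain B where B: "B \<in> sets P" "emeasure P B \<le> b"
        "\<And>x. x \<in> space P - B \<Longrightarrow> G (n - d) (u k w x)"
        using step[OF k(1) w] by (auto simp: k_def[symmetric] k(2))
      \<comment> \<open>Outside \<open>B\<close> the next round goes well and the induction
        hypothesis applies; on \<open>B\<close> the trivial bound \<open>1\<close> is paid for by
        the indicator.\<close>
      have "f (u k w x) \<le> of_nat d * b + indicator B x" if x: "x \<in> space P" for x
        using f1[OF uM[OF w x]] fG[OF uM[OF w x]] B(3)[of x] x
        by (cases "x \<in> B") (auto intro: add_increasing)
      then have "(\<integral>\<^sup>+ x. f (u k w x) \<partial>P) \<le> (\<integral>\<^sup>+ x. of_nat d * b + indicator B x \<partial>P)"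
        by (rule nn_integral_mono)
      also have "\<dots> = of_nat d * b + emeasure P B"
        using B(1) by (simp add: nn_integral_add P.emeasure_space_1)
      also have "\<dots> \<le> of_nat (Suc d) * b"
        using B(2) by (simp add: distrib_right add.commute)
      finally show "(\<integral>\<^sup>+ x. f (u k w x) \<partial>P) \<le> of_nat (Suc d) * b" .
    qed
  qed
  from this[of n] obtain f where f: "emeasure M F \<le> (\<integral>\<^sup>+ w. f w \<partial>M)"
      "\<And>w. w \<in> space M \<Longrightarrow> f w \<le> of_nat n * b"
    using start by auto
  note f(1)
  also have "(\<integral>\<^sup>+ w. f w \<partial>M) \<le> (\<integral>\<^sup>+ w. of_nat n * b \<partial>M)"
    by (intro nn_integral_mono f(2))
  finally show ?thesis
    by (simp add: M.emeasure_space_1)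
qed

section \<open>Failure probabilities and images of product measures\<close>

lemma (in prob_space) prob_ge_iff_emeasure_neg_le:
  assumes "{x \<in> space M. \<not> P x} \<in> events" "0 \<le> b"
  shows "1 - b \<le> prob {x \<in> space M. P x} \<longleftrightarrow> emeasure M {x \<in> space M. \<not> P x} \<le> ennreal b"
proof -
  have "prob (space M - {x \<in> space M. \<not> P x}) = 1 - prob {x \<in> space M. \<not> P x}"
    using assms(1) by (rule prob_compl)
  also have "space M - {x \<in> space M. \<not> P x} = {x \<in> space M. P x}"
    by auto
  finally show ?thesis
    using assms(2) by (auto simp: emeasure_eq_measure)
qed

text \<open>A product measure is determined by its finite cylinders, and the preimage of a cylinder
  under a coordinatewise map is the cylinder of the preimages. Thus a projected i.i.d. stream is an
  i.i.d. stream of the projected distribution, and the guarantees of a sub-routine over its own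
  domain apply.\<close>

lemma distr_PiM_comp:
  assumes "prob_space D" and p[measurable]: "p \<in> D \<rightarrow>\<^sub>M Z"
  shows "distr (\<Pi>\<^sub>M i\<in>(UNIV::'i set). D) (\<Pi>\<^sub>M i\<in>(UNIV::'i set). Z) (\<lambda>S. p \<circ> S) = (\<Pi>\<^sub>M i\<in>(UNIV::'i set). distr D Z p)"
proof -
  interpret D: prob_space D by fact
  interpret Dp: product_prob_space "\<lambda>_. D" "UNIV :: 'i set" ..
  interpret D': prob_space "distr D Z p" by (rule D.prob_space_distr) fact
  interpret Dp': product_prob_space "\<lambda>_. distr D Z p" "UNIV :: 'i set" ..
  have cm: "(\<lambda>S. p \<circ> S) \<in> (\<Pi>\<^sub>M i\<in>(UNIV::'i set). D) \<rightarrow>\<^sub>M (\<Pi>\<^sub>M i\<in>(UNIV::'i set). Z)"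
    by (rule measurable_PiM_single') (auto simp: space_PiM PiE_iff measurable_space[OF p])
  have sets_eq: "sets (\<Pi>\<^sub>M i\<in>(UNIV::'i set). Z) = sets (\<Pi>\<^sub>M i\<in>(UNIV::'i set). distr D Z p)"
    by (rule sets_PiM_cong) auto
  show ?thesis
  proof (rule Dp'.PiM_eq)
    show "sets (distr (\<Pi>\<^sub>M i\<in>(UNIV::'i set). D) (\<Pi>\<^sub>M i\<in>(UNIV::'i set). Z) (\<lambda>S. p \<circ> S)) = sets (\<Pi>\<^sub>M i\<in>(UNIV::'i set). distr D Z p)"
      using sets_eq by simp
    fix J and F :: "'i \<Rightarrow> 'b set"
    assume J: "finite J" "J \<subseteq> UNIV" and F: "\<And>j. j \<in> J \<Longrightarrow> F j \<in> sets (distr D Z p)"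
    let ?E = "prod_emb UNIV (\<lambda>_. distr D Z p) J (\<Pi>\<^sub>E j\<in>J. F j)"
    have "?E \<in> sets (\<Pi>\<^sub>M i\<in>(UNIV::'i set). distr D Z p)"
      using J F by (intro sets_PiM_I) auto
    then have "emeasure (distr (\<Pi>\<^sub>M i\<in>(UNIV::'i set). D) (\<Pi>\<^sub>M i\<in>(UNIV::'i set). Z) (\<lambda>S. p \<circ> S)) ?E =
        emeasure (\<Pi>\<^sub>M i\<in>(UNIV::'i set). D) ((\<lambda>S. p \<circ> S) -` ?E \<inter> space (\<Pi>\<^sub>M i\<in>(UNIV::'i set). D))"
      using sets_eq by (intro emeasure_distr[OF cm]) simp
    also have "(\<lambda>S. p \<circ> S) -` ?E \<inter> space (\<Pi>\<^sub>M i\<in>(UNIV::'i set). D) =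
        prod_emb UNIV (\<lambda>_. D) J (\<Pi>\<^sub>E j\<in>J. p -` F j \<inter> space D)"
      using measurable_space[OF p] by (auto simp: prod_emb_def space_PiM restrict_PiE_iff Pi_iff PiE_iff)
    also have "emeasure (\<Pi>\<^sub>M i\<in>(UNIV::'i set). D) \<dots> = (\<Prod>j\<in>J. emeasure D (p -` F j \<inter> space D))"
      using J F by (intro Dp.emeasure_PiM_emb) auto
    also have "\<dots> = (\<Prod>j\<in>J. emeasure (distr D Z p) (F j))"
      using F by (intro prod.cong refl) (simp add: emeasure_distr)
    finally show "emeasure (distr (\<Pi>\<^sub>M i\<in>(UNIV::'i set). D) (\<Pi>\<^sub>M i\<in>(UNIV::'i set). Z) (\<lambda>S. p \<circ> S)) ?E =
      (\<Prod>j\<in>J. emeasure (distr D Z p) (F j))" .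
  qed
qed

lemma distr_pair_prob:
  assumes "prob_space M" "prob_space M'" and f: "f \<in> M \<rightarrow>\<^sub>M N" and f': "f' \<in> M' \<rightarrow>\<^sub>M N'"
  shows "distr (M \<Otimes>\<^sub>M M') (N \<Otimes>\<^sub>M N') (\<lambda>(x, y). (f x, f' y)) = distr M N f \<Otimes>\<^sub>M distr M' N' f'"
proof -
  interpret M': prob_space M' by fact
  interpret prob_space "distr M' N' f'" by (rule M'.prob_space_distr) fact
  show ?thesis
    by (rule pair_measure_distr[symmetric, OF f f']) (rule sigma_finite_measure_axioms)
qed

section \<open>Laws of runs of a composition\<close>

lemma distributions_onD:
  assumes "D \<in> distributions_on X"
  shows "prob_space D" "sets D = sets X" "space D = space X"
  using assms by (auto simp: distributions_on_def dest: sets_eq_imp_space_eq)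

lemma sets_iid_stream_cong: "sets D = sets X \<Longrightarrow> sets (iid_stream D) = sets (iid_stream X)"
  unfolding iid_stream_def by (rule sets_PiM_cong) auto

lemma sets_iid_rounds_cong: "sets D = sets X \<Longrightarrow> sets (iid_rounds N D) = sets (iid_rounds N X)"
  unfolding iid_rounds_def by (rule sets_PiM_cong[OF refl]) (rule sets_iid_stream_cong)

lemma prob_space_iid_stream: "prob_space D \<Longrightarrow> prob_space (iid_stream D)"
  unfolding iid_stream_def by (rule prob_space_PiM)

lemma prob_space_iid_rounds: "prob_space D \<Longrightarrow> prob_space (iid_rounds N D)"
  unfolding iid_rounds_def by (intro prob_space_PiM prob_space_iid_stream)

lemma prob_space_round_strings: "prob_space R \<Longrightarrow> prob_space (round_strings N R)"
  unfolding round_strings_def by (rule prob_space_PiM)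

lemma measurable_iid_rounds_component:
  "i \<le> N \<Longrightarrow> (\<lambda>S. S i) \<in> iid_rounds N D \<rightarrow>\<^sub>M iid_stream D"
  unfolding iid_rounds_def by (rule measurable_component_singleton) simp

lemma measurable_round_strings_component:
  "i \<le> N \<Longrightarrow> (\<lambda>r. r i) \<in> round_strings N R \<rightarrow>\<^sub>M R"
  unfolding round_strings_def by (rule measurable_component_singleton) simp

section \<open>How the history depends on the rounds\<close>

lemma transcript_cong:
  assumes "\<And>i. i < n \<Longrightarrow> S i = S' i" "\<And>i. i < n \<Longrightarrow> r i = r' i"
  shows "transcript A S r n = transcript A S' r' n"
  using assms by (induction n) (auto simp: Let_def)

lemma transcript_upd [simp]:
  "transcript A (S(n := s)) (r(n := t)) n = transcript A S r n"
  by (rule transcript_cong) auto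

lemma round_index_upd [simp]: "round_index A (S(n := s)) (r(n := t)) n = round_index A S r n"
  by (simp add: round_index_def)

lemma length_transcript [simp]: "length (transcript A S r n) = n"
  by (induction n) (auto simp: Let_def)

text \<open>Redrawing round \<open>n\<close> changes only the last entry, and the sub-routine
  producing it is read off the old history. This is the shape required by the \<open>step\<close>
  premise of \<open>sequential_union_bound\<close>.\<close>

lemma transcript_Suc_upd:
  "transcript A (S(n := s)) (r(n := t)) (Suc n) =
     transcript A S r n @ [result (subroutine A (round_index A S r n)) (proj A (round_index A S r n) \<circ> s) t]"
  by (simp add: Let_def round_index_def del: fun_upd_apply) simp

text \<open>In the replicability experiment the shared string comes first and two sample families
  follow. With \<open>f\<close> a projection, forgetting one family and swapping the rest yields the
  law of a single run.\<close>

lemma distr_pair_swap_marginal: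
  assumes "prob_space L" "prob_space K'" and f: "f \<in> K' \<rightarrow>\<^sub>M K" and K: "distr K' K f = K"
  shows "distr (L \<Otimes>\<^sub>M K') (K \<Otimes>\<^sub>M L) (\<lambda>w. (f (snd w), fst w)) = K \<Otimes>\<^sub>M L"
proof -
  interpret L: prob_space L by fact
  interpret K': prob_space K' by fact
  interpret K: prob_space K
    using K'.prob_space_distr[OF f] K by simp
  interpret KL: pair_sigma_finite K L ..
  have "distr (L \<Otimes>\<^sub>M K') (L \<Otimes>\<^sub>M K) (\<lambda>(x, y). (x, f y)) = L \<Otimes>\<^sub>M K"
    using distr_pair_prob[OF assms(1,2) measurable_ident_sets[OF refl] f] by (simp add: K distr_id2)
  then have "K \<Otimes>\<^sub>M L = distr (distr (L \<Otimes>\<^sub>M K') (L \<Otimes>\<^sub>M K) (\<lambda>(x, y). (x, f y)))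
      (K \<Otimes>\<^sub>M L) (\<lambda>(x, y). (y, x))"
    by (metis KL.distr_pair_swap)
  also have "\<dots> = distr (L \<Otimes>\<^sub>M K') (K \<Otimes>\<^sub>M L) (\<lambda>w. (f (snd w), fst w))"
    using f by (subst distr_distr) (auto simp: comp_def split_beta)
  finally show ?thesis by simp
qed

locale adaptive =
  fixes N :: nat and R :: "'r measure" and Q :: "'j \<Rightarrow> ('z, 'y) problem"
    and QA :: "('x, 'w) problem" and A :: "('x, 'z, 'r, 'y, 'j, 'w) composition"
  assumes adaptive: "adaptive_composition N R Q QA A"
begin

abbreviation round_law :: "'x measure \<Rightarrow> ((nat \<Rightarrow> 'x) \<times> 'r) measure" where
  "round_law D \<equiv> iid_stream D \<Otimes>\<^sub>M R"

abbreviation run_law :: "'x measure \<Rightarrow> ((nat \<Rightarrow> nat \<Rightarrow> 'x) \<times> (nat \<Rightarrow> 'r)) measure" where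
  "run_law D \<equiv> iid_rounds N D \<Otimes>\<^sub>M round_strings N R"

abbreviation round_law2 :: "'x measure \<Rightarrow> ('r \<times> (nat \<Rightarrow> 'x) \<times> (nat \<Rightarrow> 'x)) measure" where
  "round_law2 D \<equiv> R \<Otimes>\<^sub>M (iid_stream D \<Otimes>\<^sub>M iid_stream D)"

abbreviation run_law2 ::
    "'x measure \<Rightarrow> ((nat \<Rightarrow> 'r) \<times> (nat \<Rightarrow> nat \<Rightarrow> 'x) \<times> (nat \<Rightarrow> nat \<Rightarrow> 'x)) measure" where
  "run_law2 D \<equiv> round_strings N R \<Otimes>\<^sub>M (iid_rounds N D \<Otimes>\<^sub>M iid_rounds N D)"

abbreviation sub_law :: "'j \<Rightarrow> 'x measure \<Rightarrow> ((nat \<Rightarrow> 'z) \<times> 'r) measure" where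
  "sub_law j D \<equiv> iid_stream (sub_dist Q A j D) \<Otimes>\<^sub>M R"

lemma prob_R: "prob_space R"
  using adaptive by (simp add: adaptive_composition_def)

lemma proj_measurable: "proj A j \<in> dom_space QA \<rightarrow>\<^sub>M dom_space (Q j)"
  using adaptive by (simp add: adaptive_composition_def)

lemma subroutine_algorithm: "algorithm (dom_space (Q j)) R (sol_space (Q j)) (subroutine A j)"
  using adaptive by (simp add: adaptive_composition_def)

lemma post_cutoff_algorithm: "algorithm (dom_space QA) R (sol_space QA) (post_cutoff A)"
  using adaptive by (simp add: adaptive_composition_def)

lemma sub_problem: "statistical_problem (Q j)"
  using adaptive by (simp add: adaptive_composition_def)

lemma composed_problem: "statistical_problem QA"
  using adaptive by (simp add: adaptive_composition_def)

lemma prob_spaces: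
  assumes "D \<in> distributions_on (dom_space QA)"
  shows "prob_space (round_law D)" "prob_space (run_law D)"
    "prob_space (round_law2 D)" "prob_space (run_law2 D)"
  using distributions_onD[OF assms] prob_R
  by (auto intro!: prob_space_pair prob_space_iid_stream prob_space_iid_rounds
      prob_space_round_strings)

text \<open>Stream and string of a round are redrawn together. The case \<open>i = N\<close> is the
  component reserved for the post-cutoff procedure.\<close>

lemma resampling_run_law:
  assumes "D \<in> distributions_on (dom_space QA)" "i \<le> N"
  shows "resampling (run_law D) (round_law D)
    (\<lambda>w x. ((fst w)(i := fst x), (snd w)(i := snd x)))"
  using distributions_onD[OF assms(1)] prob_R assms(2)
  unfolding iid_rounds_def round_strings_def
  by (intro resampling_pair resampling_PiM prob_space_PiM prob_space_iid_stream) auto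

text \<open>A round of the paired experiment has one fresh string, shared by both runs, and two
  independent streams.\<close>

lemma resampling_run_law2:
  assumes "D \<in> distributions_on (dom_space QA)" "i \<le> N"
  shows "resampling (run_law2 D) (round_law2 D)
    (\<lambda>w x. ((fst w)(i := fst x),
      ((fst (snd w))(i := fst (snd x)), (snd (snd w))(i := snd (snd x)))))"
  using distributions_onD[OF assms(1)] prob_R assms(2)
  unfolding iid_rounds_def round_strings_def
  by (intro resampling_pair[where u' = "\<lambda>w x. ((fst w)(i := fst x), (snd w)(i := snd x))"]
      resampling_pair resampling_PiM prob_space_PiM prob_space_iid_stream prob_space_pair) auto

lemma sets_run_law:
  assumes "D \<in> distributions_on (dom_space QA)"
  shows "sets (run_law D) = sets (run_law (dom_space QA))"
  using sets_iid_rounds_cong[OF distributions_onD(2)[OF assms], of N]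
  by (intro sets_pair_measure_cong) auto

lemma sets_round_law:
  assumes "D \<in> distributions_on (dom_space QA)"
  shows "sets (round_law D) = sets (round_law (dom_space QA))"
  using sets_iid_stream_cong[OF distributions_onD(2)[OF assms]]
  by (intro sets_pair_measure_cong) auto

lemma run_law_measurable:
  assumes "D \<in> distributions_on (dom_space QA)" "f \<in> run_law (dom_space QA) \<rightarrow>\<^sub>M Y"
  shows "f \<in> run_law D \<rightarrow>\<^sub>M Y"
  using assms(2) measurable_cong_sets[OF sets_run_law[OF assms(1)] refl] by blast

lemma proj_measurable':
  assumes "D \<in> distributions_on (dom_space QA)"
  shows "proj A j \<in> D \<rightarrow>\<^sub>M dom_space (Q j)"
  using proj_measurable measurable_cong_sets[OF distributions_onD(2)[OF assms] refl] by blast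

lemma sub_dist_distribution:
  assumes "D \<in> distributions_on (dom_space QA)"
  shows "sub_dist Q A j D \<in> distributions_on (dom_space (Q j))"
  using prob_space.prob_space_distr[OF distributions_onD(1)[OF assms] proj_measurable'[OF assms]]
  by (simp add: distributions_on_def sub_dist_def)

lemma proj_stream_measurable:
  assumes "D \<in> distributions_on (dom_space QA)"
  shows "(\<lambda>s. proj A j \<circ> s) \<in> iid_stream D \<rightarrow>\<^sub>M iid_stream (dom_space (Q j))"
  unfolding iid_stream_def
  by (rule measurable_PiM_single')
    (auto simp: space_PiM PiE_iff measurable_space[OF proj_measurable'[OF assms]]
      intro!: measurable_compose[OF _ proj_measurable'[OF assms]])

lemma distr_proj_stream:
  assumes "D \<in> distributions_on (dom_space QA)"
  shows "distr (iid_stream D) (iid_stream (dom_space (Q j))) (\<lambda>s. proj A j \<circ> s) =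
    iid_stream (sub_dist Q A j D)"
  unfolding iid_stream_def sub_dist_def
  by (rule distr_PiM_comp[OF distributions_onD(1)[OF assms] proj_measurable'[OF assms]])

text \<open>The bridge from a round of the composition to the experiment in which the guarantees of
  \<open>subroutine A j\<close> are stated; \<open>distr_round_law2\<close> is its counterpart for
  two runs with a shared string.\<close>

lemma distr_round_law:
  assumes "D \<in> distributions_on (dom_space QA)"
  shows "distr (round_law D) (iid_stream (dom_space (Q j)) \<Otimes>\<^sub>M R) (\<lambda>(s, t). (proj A j \<circ> s, t)) =
    sub_law j D"
  using distr_pair_prob[OF prob_space_iid_stream[OF distributions_onD(1)[OF assms]] prob_R
      proj_stream_measurable[OF assms] measurable_ident_sets[OF refl]]
  by (simp add: distr_proj_stream[OF assms] distr_id2)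

lemma distr_round_law2:
  assumes "D \<in> distributions_on (dom_space QA)"
  shows "distr (round_law2 D)
      (R \<Otimes>\<^sub>M (iid_stream (dom_space (Q j)) \<Otimes>\<^sub>M iid_stream (dom_space (Q j))))
      (\<lambda>(t, s, s'). (t, proj A j \<circ> s, proj A j \<circ> s')) =
    R \<Otimes>\<^sub>M (iid_stream (sub_dist Q A j D) \<Otimes>\<^sub>M iid_stream (sub_dist Q A j D))"
proof -
  note D = prob_space_iid_stream[OF distributions_onD(1)[OF assms]]
  let ?Z = "iid_stream (dom_space (Q j))"
  let ?p = "\<lambda>(s :: nat \<Rightarrow> 'x, s' :: nat \<Rightarrow> 'x). (proj A j \<circ> s, proj A j \<circ> s')"
  have m: "?p \<in> iid_stream D \<Otimes>\<^sub>M iid_stream D \<rightarrow>\<^sub>M ?Z \<Otimes>\<^sub>M ?Z"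
    unfolding split_beta
    by (intro measurable_Pair measurable_compose[OF _ proj_stream_measurable[OF assms]]) auto
  have "(\<lambda>(t :: 'r, s, s'). (t, proj A j \<circ> s, proj A j \<circ> s')) = (\<lambda>(t, x). (t, ?p x))"
    by auto
  then have "distr (round_law2 D) (R \<Otimes>\<^sub>M (?Z \<Otimes>\<^sub>M ?Z)) (\<lambda>(t, s, s'). (t, proj A j \<circ> s, proj A j \<circ> s')) =
      distr R R (\<lambda>t. t) \<Otimes>\<^sub>M distr (iid_stream D \<Otimes>\<^sub>M iid_stream D) (?Z \<Otimes>\<^sub>M ?Z) ?p"
    using distr_pair_prob[OF prob_R prob_space_pair[OF D D] measurable_ident_sets[OF refl] m]
    by (simp only:)
  also have "distr (iid_stream D \<Otimes>\<^sub>M iid_stream D) (?Z \<Otimes>\<^sub>M ?Z) ?p =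
      iid_stream (sub_dist Q A j D) \<Otimes>\<^sub>M iid_stream (sub_dist Q A j D)"
    using distr_pair_prob[OF D D proj_stream_measurable[OF assms] proj_stream_measurable[OF assms]]
    by (simp add: distr_proj_stream[OF assms])
  finally show ?thesis
    unfolding distr_id2[OF refl] .
qed

lemma round_law_measurable:
  assumes "D \<in> distributions_on (dom_space QA)"
  shows "(\<lambda>(s, t). (proj A j \<circ> s, t)) \<in> round_law D \<rightarrow>\<^sub>M iid_stream (dom_space (Q j)) \<Otimes>\<^sub>M R"
  unfolding split_beta
  by (intro measurable_Pair measurable_compose[OF _ proj_stream_measurable[OF assms]]) auto

lemma round_law2_measurable:
  assumes "D \<in> distributions_on (dom_space QA)"
  shows "(\<lambda>(t, s, s'). (t, proj A j \<circ> s, proj A j \<circ> s')) \<in> round_law2 D \<rightarrow>\<^sub>M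
    R \<Otimes>\<^sub>M (iid_stream (dom_space (Q j)) \<Otimes>\<^sub>M iid_stream (dom_space (Q j)))"
  unfolding split_beta
  by (intro measurable_Pair measurable_compose[OF _ proj_stream_measurable[OF assms]]) auto

lemma nn_integral_sub_law:
  assumes "D \<in> distributions_on (dom_space QA)"
    and "(\<lambda>(s, t). f s t) \<in> borel_measurable (iid_stream (dom_space (Q j)) \<Otimes>\<^sub>M R)"
  shows "(\<integral>\<^sup>+ x. f (proj A j \<circ> fst x) (snd x) \<partial>round_law D) = (\<integral>\<^sup>+ (s, t). f s t \<partial>sub_law j D)"
  unfolding distr_round_law[OF assms(1), symmetric]
  using assms(2) round_law_measurable[OF assms(1)]
  by (subst nn_integral_distr) (auto simp: split_beta)

text \<open>While round \<open>i\<close> is redrawn, \<open>round_index A S r i\<close> stays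
  constant, so the inner integral is that of a single \<open>f j\<close> and is at most
  \<open>b\<close>. Measurability of \<open>F\<close> is a separate premise because nothing makes
  the selection of \<open>j\<close> measurable.\<close>

lemma nn_integral_round_le:
  fixes f :: "'j \<Rightarrow> (nat \<Rightarrow> 'z) \<Rightarrow> 'r \<Rightarrow> ennreal"
  assumes D: "D \<in> distributions_on (dom_space QA)" and "i < N"
    and f: "\<And>j. (\<lambda>(s, t). f j s t) \<in> borel_measurable (iid_stream (dom_space (Q j)) \<Otimes>\<^sub>M R)"
    and F: "F \<in> borel_measurable (run_law D)"
    and F_eq: "\<And>S r. F (S, r) = f (round_index A S r i) (proj A (round_index A S r i) \<circ> S i) (r i)"
    and b: "\<And>j. (\<integral>\<^sup>+ (s, t). f j s t \<partial>sub_law j D) \<le> b"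
  shows "(\<integral>\<^sup>+ w. F w \<partial>run_law D) \<le> b"
proof -
  interpret prob_space "run_law D" by (rule prob_spaces[OF D])
  have "(\<integral>\<^sup>+ w. F w \<partial>run_law D) \<le> (\<integral>\<^sup>+ w. b \<partial>run_law D)"
  proof (rule resampling_nn_integral_le[OF resampling_run_law[OF D less_imp_le[OF \<open>i < N\<close>]] F])
    fix w :: "(nat \<Rightarrow> nat \<Rightarrow> 'x) \<times> (nat \<Rightarrow> 'r)"
    show "(\<integral>\<^sup>+ x. F ((fst w)(i := fst x), (snd w)(i := snd x)) \<partial>round_law D) \<le> b"
      using nn_integral_sub_law[OF D f, of "round_index A (fst w) (snd w) i"] b
      by (simp add: F_eq)
  qed
  then show ?thesis
    by (simp add: emeasure_space_1)
qed

section \<open>Measurability of the quantities of a run\<close>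

lemma round_samples_measurable:
  assumes "D \<in> distributions_on (dom_space QA)" "i < N"
  shows "(\<lambda>w. ennreal_of_enat (round_samples A (fst w) (snd w) i)) \<in> borel_measurable (run_law D)"
proof -
  have "(\<lambda>(S, r). round_samples A S r i) \<in> run_law (dom_space QA) \<rightarrow>\<^sub>M count_space UNIV"
    using adaptive assms(2) by (simp add: adaptive_composition_def)
  from measurable_compose[OF run_law_measurable[OF assms(1) this], of ennreal_of_enat borel]
  show ?thesis by (simp add: split_beta)
qed

lemma round_runtime_measurable:
  assumes "D \<in> distributions_on (dom_space QA)" "i < N"
  shows "(\<lambda>w. round_runtime A (fst w) (snd w) i) \<in> borel_measurable (run_law D)"
proof -
  have "(\<lambda>(S, r). round_runtime A S r i) \<in> borel_measurable (run_law (dom_space QA))"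
    using adaptive assms(2) by (simp add: adaptive_composition_def)
  from run_law_measurable[OF assms(1) this] show ?thesis by (simp add: split_beta)
qed

lemma aggregate_measurable:
  assumes "D \<in> distributions_on (dom_space QA)"
  shows "(\<lambda>w. aggregate A (transcript A (fst w) (snd w) N)) \<in> run_law D \<rightarrow>\<^sub>M sol_space QA"
proof -
  have "(\<lambda>(S, r). aggregate A (transcript A S r N)) \<in> run_law (dom_space QA) \<rightarrow>\<^sub>M sol_space QA"
    using adaptive by (simp add: adaptive_composition_def)
  from run_law_measurable[OF assms(1) this] show ?thesis by (simp add: split_beta)
qed

lemma post_cutoff_measurable:
  assumes "D \<in> distributions_on (dom_space QA)"
    and "(\<lambda>(s, t). f s t) \<in> round_law (dom_space QA) \<rightarrow>\<^sub>M Y"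
  shows "(\<lambda>w. f (fst w N) (snd w N)) \<in> run_law D \<rightarrow>\<^sub>M Y"
proof -
  have "(\<lambda>w. (fst w N, snd w N)) \<in> run_law D \<rightarrow>\<^sub>M round_law D"
    by (intro measurable_Pair measurable_compose[OF measurable_fst]
        measurable_compose[OF measurable_snd] measurable_iid_rounds_component
        measurable_round_strings_component) auto
  moreover have "(\<lambda>(s, t). f s t) \<in> round_law D \<rightarrow>\<^sub>M Y"
    using assms(2) measurable_cong_sets[OF sets_round_law[OF assms(1)] refl] by blast
  ultimately show ?thesis
    using measurable_compose by fastforce
qed

lemma samples_before_measurable:
  assumes "D \<in> distributions_on (dom_space QA)"
  shows "(\<lambda>w. ennreal_of_enat (samples_before A (fst w) (snd w) N)) \<in> borel_measurable (run_law D)"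
  unfolding samples_before_def sum_ennreal_of_enat[symmetric]
  by (intro borel_measurable_sum round_samples_measurable[OF assms]) simp

text \<open>Sample counts are integers, so exceeding \<open>m\<close> means reaching
  \<open>m + 1\<close>. This extra unit lets Markov's inequality work with a cutoff that is rounded
  down.\<close>

lemma cut_off_iff:
  "cut_off N m A S r \<longleftrightarrow> of_nat (Suc m) \<le> ennreal_of_enat (samples_before A S r N)"
  unfolding cut_off_def
  by (metis Suc_ile_eq ennreal_of_enat_enat ennreal_of_enat_le_iff)

lemma cut_off_sets:
  assumes "D \<in> distributions_on (dom_space QA)"
  shows "{w \<in> space (run_law D). cut_off N m A (fst w) (snd w)} \<in> sets (run_law D)"
proof -
  note samples_before_measurable[OF assms, measurable]
  show ?thesis unfolding cut_off_iff by measurable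
qed


section \<open>Correctness and agreement of the sub-routines\<close>

text \<open>Supplies the bad set of a round for correctness. With \<open>j\<close> fixed it is
  measurable, being the preimage under the projection of a failure set in the sub-routine's own
  domain; its probability transfers along \<open>distr_round_law\<close>.\<close>

lemma sub_failure:
  assumes "D \<in> dists QA" "sub_dist Q A j D \<in> dists (Q j)" "0 < \<delta>"
    and "delta_correct iid_stream R (Q j) \<delta> (subroutine A j)"
  shows "{x \<in> space (round_law D). result (subroutine A j) (proj A j \<circ> fst x) (snd x)
      \<notin> correct_sols (Q j) (sub_dist Q A j D)} \<in> sets (round_law D)" (is "?B \<in> _")
    and "emeasure (round_law D) {x \<in> space (round_law D). result (subroutine A j) (proj A j \<circ> fst x) (snd x)
      \<notin> correct_sols (Q j) (sub_dist Q A j D)} \<le> ennreal \<delta>"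
proof -
  have D: "D \<in> distributions_on (dom_space QA)"
    using composed_problem assms(1) by (auto simp: statistical_problem_def)
  note D' = distributions_onD[OF sub_dist_distribution[OF D, of j]]
  interpret prob_space "sub_law j D"
    by (intro prob_space_pair prob_space_iid_stream D' prob_R)
  let ?Z = "iid_stream (dom_space (Q j)) \<Otimes>\<^sub>M R"
  let ?C = "correct_sols (Q j) (sub_dist Q A j D)"
  have sets_eq: "sets (sub_law j D) = sets ?Z"
    by (intro sets_pair_measure_cong sets_iid_stream_cong D' refl)
  have res: "(\<lambda>(s, t). result (subroutine A j) s t) \<in> ?Z \<rightarrow>\<^sub>M sol_space (Q j)"
    using subroutine_algorithm by (simp add: algorithm_def)
  have C: "?C \<in> sets (sol_space (Q j))"
    using sub_problem assms(2) by (simp add: statistical_problem_def)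
  let ?E = "{(s, t) \<in> space ?Z. result (subroutine A j) s t \<notin> ?C}"
  have "(\<lambda>(s, t). result (subroutine A j) s t) -` ?C \<inter> space ?Z \<in> sets ?Z"
    by (rule measurable_sets[OF res C])
  then have "space ?Z - (\<lambda>(s, t). result (subroutine A j) s t) -` ?C \<inter> space ?Z \<in> sets ?Z"
    by auto
  also have "space ?Z - (\<lambda>(s, t). result (subroutine A j) s t) -` ?C \<inter> space ?Z = ?E"
    by auto
  finally have E: "?E \<in> sets ?Z" .
  note m = round_law_measurable[OF D, of j]
  have B_eq: "?B = (\<lambda>(s, t). (proj A j \<circ> s, t)) -` ?E \<inter> space (round_law D)"
    using measurable_space[OF m] by auto
  show B: "?B \<in> sets (round_law D)"
    unfolding B_eq by (rule measurable_sets[OF m E])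
  have "emeasure (round_law D) ?B = emeasure (sub_law j D) ?E"
    unfolding B_eq distr_round_law[OF D, symmetric] by (rule emeasure_distr[symmetric, OF m E])
  also have "\<dots> = emeasure (sub_law j D)
      {x \<in> space (sub_law j D). \<not> (case x of (s, t) \<Rightarrow> result (subroutine A j) s t \<in> ?C)}"
    using sets_eq_imp_space_eq[OF sets_eq] by (intro arg_cong[where f = "emeasure _"]) auto
  also have "\<dots> \<le> ennreal \<delta>"
  proof (subst prob_ge_iff_emeasure_neg_le[symmetric])
    have "{x \<in> space (sub_law j D). \<not> (case x of (s, t) \<Rightarrow> result (subroutine A j) s t \<in> ?C)} = ?E"
      using sets_eq_imp_space_eq[OF sets_eq] by auto
    then show "{x \<in> space (sub_law j D). \<not> (case x of (s, t) \<Rightarrow> result (subroutine A j) s t \<in> ?C)}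
        \<in> events"
      using E sets_eq by simp
    show "0 \<le> \<delta>" using assms(3) by simp
    have "1 - \<delta> \<le> prob {(s, t) \<in> space (sub_law j D). result (subroutine A j) s t \<in> ?C}"
      using assms(2,4) by (simp add: delta_correct_def)
    also have "{(s, t) \<in> space (sub_law j D). result (subroutine A j) s t \<in> ?C} =
        {x \<in> space (sub_law j D). case x of (s, t) \<Rightarrow> result (subroutine A j) s t \<in> ?C}"
      by auto
    finally show "1 - \<delta> \<le> prob {x \<in> space (sub_law j D). case x of (s, t) \<Rightarrow> result (subroutine A j) s t \<in> ?C}" .
  qed
  finally show "emeasure (round_law D) ?B \<le> ennreal \<delta>" .
qed

text \<open>Supplies the bad set of a round for replicability. Its measurability rests on the
  measurable diagonal in \<open>statistical_problem\<close>, its probability on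
  \<open>distr_round_law2\<close>.\<close>

lemma sub_disagreement:
  assumes D: "D \<in> distributions_on (dom_space QA)" and "0 < \<rho>"
    and rep: "replicable iid_stream R (dom_space (Q j)) \<rho> (subroutine A j)"
  shows "{x \<in> space (round_law2 D). result (subroutine A j) (proj A j \<circ> fst (snd x)) (fst x) \<noteq>
      result (subroutine A j) (proj A j \<circ> snd (snd x)) (fst x)} \<in> sets (round_law2 D)" (is "?B \<in> _")
    and "emeasure (round_law2 D)
      {x \<in> space (round_law2 D). result (subroutine A j) (proj A j \<circ> fst (snd x)) (fst x) \<noteq>
      result (subroutine A j) (proj A j \<circ> snd (snd x)) (fst x)} \<le> ennreal \<rho>"
proof -
  let ?Z1 = "iid_stream (dom_space (Q j))"
  let ?T = "iid_stream (sub_dist Q A j D)"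
  let ?Z = "R \<Otimes>\<^sub>M (?Z1 \<Otimes>\<^sub>M ?Z1)"
  let ?L = "R \<Otimes>\<^sub>M (?T \<Otimes>\<^sub>M ?T)"
  note D' = distributions_onD[OF sub_dist_distribution[OF D, of j]]
  interpret prob_space ?L
    by (intro prob_space_pair prob_space_iid_stream D' prob_R)
  have sets_eq: "sets ?L = sets ?Z"
    by (intro sets_pair_measure_cong sets_iid_stream_cong D' refl)
  have res: "(\<lambda>(s, t). result (subroutine A j) s t) \<in> ?Z1 \<Otimes>\<^sub>M R \<rightarrow>\<^sub>M sol_space (Q j)"
    using subroutine_algorithm by (simp add: algorithm_def)
  have res': "(\<lambda>x. result (subroutine A j) (f x) (g x)) \<in> ?Z \<rightarrow>\<^sub>M sol_space (Q j)"
    if "f \<in> ?Z \<rightarrow>\<^sub>M ?Z1" "g \<in> ?Z \<rightarrow>\<^sub>M R" for f g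
    using measurable_compose[OF measurable_Pair[OF that] res] by simp
  let ?E = "{(t, s, s') \<in> space ?Z. result (subroutine A j) s t \<noteq> result (subroutine A j) s' t}"
  let ?d = "{p \<in> space (sol_space (Q j) \<Otimes>\<^sub>M sol_space (Q j)). fst p = snd p}"
  let ?rr = "\<lambda>x. (result (subroutine A j) (fst (snd x)) (fst x), result (subroutine A j) (snd (snd x)) (fst x))"
  have rr: "?rr \<in> ?Z \<rightarrow>\<^sub>M sol_space (Q j) \<Otimes>\<^sub>M sol_space (Q j)"
    by (intro measurable_Pair res') auto
  have "?d \<in> sets (sol_space (Q j) \<Otimes>\<^sub>M sol_space (Q j))"
    using sub_problem by (simp add: statistical_problem_def)
  from measurable_sets[OF rr this]
  have "space ?Z - ?rr -` ?d \<inter> space ?Z \<in> sets ?Z"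
    by auto
  also have "space ?Z - ?rr -` ?d \<inter> space ?Z = ?E"
    using measurable_space[OF rr] by auto
  finally have E: "?E \<in> sets ?Z" .
  note m = round_law2_measurable[OF D, of j]
  have B_eq: "?B = (\<lambda>(t, s, s'). (t, proj A j \<circ> s, proj A j \<circ> s')) -` ?E \<inter> space (round_law2 D)"
    using measurable_space[OF m] by auto
  show B: "?B \<in> sets (round_law2 D)"
    unfolding B_eq by (rule measurable_sets[OF m E])
  have "emeasure (round_law2 D) ?B = emeasure ?L ?E"
    unfolding B_eq distr_round_law2[OF D, symmetric] by (rule emeasure_distr[symmetric, OF m E])
  also have "?E = {x \<in> space ?L. \<not> (case x of (t, s, s') \<Rightarrow>
      result (subroutine A j) s t = result (subroutine A j) s' t)}" (is "_ = ?E'")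
    using sets_eq_imp_space_eq[OF sets_eq] by auto
  also have "emeasure ?L ?E' \<le> ennreal \<rho>"
  proof (subst prob_ge_iff_emeasure_neg_le[symmetric])
    show "?E' \<in> events"
      using E sets_eq \<open>?E = ?E'\<close> by simp
    show "0 \<le> \<rho>" using assms(2) by simp
    have "1 - \<rho> \<le> prob {(t, s, s') \<in> space ?L. result (subroutine A j) s t = result (subroutine A j) s' t}"
      using rep sub_dist_distribution[OF D, of j] by (simp add: replicable_def)
    also have "{(t, s, s') \<in> space ?L. result (subroutine A j) s t = result (subroutine A j) s' t} =
        {x \<in> space ?L. case x of (t, s, s') \<Rightarrow> result (subroutine A j) s t = result (subroutine A j) s' t}"
      by auto
    finally show "1 - \<rho> \<le> prob {x \<in> space ?L. case x of (t, s, s') \<Rightarrow>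
        result (subroutine A j) s t = result (subroutine A j) s' t}" .
  qed
  finally show "emeasure (round_law2 D) ?B \<le> ennreal \<rho>" .
qed

text \<open>The union bound with the invariant that all outputs so far are correct; after
  \<open>N\<close> rounds consistency forces a correct aggregate.\<close>

lemma aggregate_failure:
  assumes D: "D \<in> dists QA" and con: "consistent N Q QA A" and "0 < \<delta>"
    and corr: "\<And>j. delta_correct iid_stream R (Q j) \<delta> (subroutine A j)"
  defines "F \<equiv> {w \<in> space (run_law D). aggregate A (transcript A (fst w) (snd w) N) \<notin> correct_sols QA D}"
  shows "F \<in> sets (run_law D)" "emeasure (run_law D) F \<le> of_nat N * ennreal \<delta>"
proof -
  have D': "D \<in> distributions_on (dom_space QA)"
    using composed_problem D by (auto simp: statistical_problem_def)
  have C[measurable]: "correct_sols QA D \<in> sets (sol_space QA)"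
    using composed_problem D by (simp add: statistical_problem_def)
  note aggregate_measurable[OF D', measurable]
  show F: "F \<in> sets (run_law D)"
    unfolding F_def by measurable
  \<comment> \<open>The history before round \<open>i\<close> is written as a prefix of the outputs,
    to match \<open>consistent\<close>.\<close>
  define G where "G k w \<longleftrightarrow> (\<forall>i<k. let j = next_sub A (take i (transcript A (fst w) (snd w) k))
      in transcript A (fst w) (snd w) k ! i \<in> correct_sols (Q j) (sub_dist Q A j D))" for k w
  have sub: "sub_dist Q A j D \<in> dists (Q j)" for j
    using con D by (simp add: consistent_def)
  show "emeasure (run_law D) F \<le> of_nat N * ennreal \<delta>"
  proof (rule sequential_union_bound[where G = G and P = "round_law D" and
        u = "\<lambda>i w x. ((fst w)(i := fst x), (snd w)(i := snd x))"])
    show "prob_space (round_law D)" "prob_space (run_law D)"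
      by (intro prob_spaces D')+
    show "resampling (run_law D) (round_law D) (\<lambda>w x. ((fst w)(k := fst x), (snd w)(k := snd x)))"
      if "k < N" for k
      using that by (intro resampling_run_law D') simp
    show "F \<in> sets (run_law D)" by fact
    show "G 0 w" for w
      by (simp add: G_def)
    show False if "w \<in> F" "G N w" for w
    proof -
      have "aggregate A (transcript A (fst w) (snd w) N) \<in> correct_sols QA D"
        using con D that(2) unfolding consistent_def G_def by simp
      then show False using that(1) by (simp add: F_def)
    qed
    fix k and w :: "(nat \<Rightarrow> nat \<Rightarrow> 'x) \<times> (nat \<Rightarrow> 'r)"
    assume k: "k < N" and G: "G k w"
    define j where "j = round_index A (fst w) (snd w) k"
    let ?B = "{x \<in> space (round_law D). result (subroutine A j) (proj A j \<circ> fst x) (snd x)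
      \<notin> correct_sols (Q j) (sub_dist Q A j D)}"
    have "G (Suc k) ((fst w)(k := fst x), (snd w)(k := snd x))" if x: "x \<in> space (round_law D) - ?B" for x
    proof -
      have "result (subroutine A j) (proj A j \<circ> fst x) (snd x) \<in> correct_sols (Q j) (sub_dist Q A j D)"
        using x by auto
      then show ?thesis
        using G unfolding G_def fst_conv snd_conv transcript_Suc_upd
        by (auto simp: less_Suc_eq nth_append Let_def j_def round_index_def)
    qed
    then show "\<exists>B\<in>sets (round_law D). emeasure (round_law D) B \<le> ennreal \<delta> \<and>
      (\<forall>x\<in>space (round_law D) - B. G (Suc k) ((fst w)(k := fst x), (snd w)(k := snd x)))"
      using sub_failure[OF D sub \<open>0 < \<delta>\<close> corr, of j] by blast
  qed
qed

text \<open>The invariant is that both transcripts coincide. Only then do the two runs call the same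
  sub-routine with the same string, so that its replicability speaks about them.\<close>

lemma aggregate_disagreement:
  assumes D: "D \<in> distributions_on (dom_space QA)" and "0 < \<rho>"
    and rep: "\<And>j. replicable iid_stream R (dom_space (Q j)) \<rho> (subroutine A j)"
    and F: "F \<in> sets (run_law2 D)"
    and F_agg: "\<And>w. w \<in> F \<Longrightarrow> aggregate A (transcript A (fst (snd w)) (fst w) N) \<noteq>
      aggregate A (transcript A (snd (snd w)) (fst w) N)"
  shows "emeasure (run_law2 D) F \<le> of_nat N * ennreal \<rho>"
proof -
  define G where "G k w \<longleftrightarrow> transcript A (fst (snd w)) (fst w) k = transcript A (snd (snd w)) (fst w) k"
    for k and w :: "(nat \<Rightarrow> 'r) \<times> (nat \<Rightarrow> nat \<Rightarrow> 'x) \<times> (nat \<Rightarrow> nat \<Rightarrow> 'x)"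
  let ?u = "\<lambda>i w x. ((fst w)(i := fst x),
      ((fst (snd w))(i := fst (snd x)), (snd (snd w))(i := snd (snd x))))"
  show ?thesis
  proof (rule sequential_union_bound[where G = G and P = "round_law2 D" and u = ?u])
    show "prob_space (round_law2 D)" "prob_space (run_law2 D)"
      by (intro prob_spaces D)+
    show "resampling (run_law2 D) (round_law2 D) (?u k)" if "k < N" for k
      using that by (intro resampling_run_law2 D) simp
    show "F \<in> sets (run_law2 D)" by fact
    show "G 0 w" for w
      by (simp add: G_def)
    show False if "w \<in> F" "G N w" for w
      using F_agg[OF that(1)] that(2) by (simp add: G_def)
    fix k and w :: "(nat \<Rightarrow> 'r) \<times> (nat \<Rightarrow> nat \<Rightarrow> 'x) \<times> (nat \<Rightarrow> nat \<Rightarrow> 'x)"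
    assume k: "k < N" and G: "G k w"
    define j where "j = round_index A (fst (snd w)) (fst w) k"
    have j': "round_index A (snd (snd w)) (fst w) k = j"
      using G by (simp add: j_def round_index_def G_def)
    let ?B = "{x \<in> space (round_law2 D). result (subroutine A j) (proj A j \<circ> fst (snd x)) (fst x) \<noteq>
      result (subroutine A j) (proj A j \<circ> snd (snd x)) (fst x)}"
    have "G (Suc k) (?u k w x)" if "x \<in> space (round_law2 D) - ?B" for x
    proof -
      have "result (subroutine A j) (proj A j \<circ> fst (snd x)) (fst x) =
          result (subroutine A j) (proj A j \<circ> snd (snd x)) (fst x)"
        using that by auto
      then show ?thesis
        using G unfolding G_def fst_conv snd_conv transcript_Suc_upd j'
        by (simp add: j_def)
    qed
    then show "\<exists>B\<in>sets (round_law2 D). emeasure (round_law2 D) B \<le> ennreal \<rho> \<and>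
      (\<forall>x\<in>space (round_law2 D) - B. G (Suc k) (?u k w x))"
      using sub_disagreement[OF D \<open>0 < \<rho>\<close> rep, of j] by blast
  qed
qed

text \<open>The procedure reads component \<open>N\<close> alone, so redrawing that component
  reproduces its own experiment. Failures are counted over all runs, cut off or not.\<close>

lemma post_cutoff_failure:
  assumes D: "D \<in> dists QA" and "0 < \<delta>"
    and corr: "delta_correct iid_stream R QA \<delta> (post_cutoff A)"
  defines "F \<equiv> {w \<in> space (run_law D). result (post_cutoff A) (fst w N) (snd w N) \<notin> correct_sols QA D}"
  shows "F \<in> sets (run_law D)" "emeasure (run_law D) F \<le> ennreal \<delta>"
proof -
  have D': "D \<in> distributions_on (dom_space QA)"
    using composed_problem D by (auto simp: statistical_problem_def)
  interpret R: prob_space "round_law D" by (rule prob_spaces[OF D'])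
  interpret M: prob_space "run_law D" by (rule prob_spaces[OF D'])
  have C[measurable]: "correct_sols QA D \<in> sets (sol_space QA)"
    using composed_problem D by (simp add: statistical_problem_def)
  have res: "(\<lambda>(s, t). result (post_cutoff A) s t) \<in> round_law (dom_space QA) \<rightarrow>\<^sub>M sol_space QA"
    using post_cutoff_algorithm by (simp add: algorithm_def)
  note post_cutoff_measurable[OF D' res, measurable]
  show F: "F \<in> sets (run_law D)"
    unfolding F_def by measurable
  have res'[measurable]: "(\<lambda>(s, t). result (post_cutoff A) s t) \<in> round_law D \<rightarrow>\<^sub>M sol_space QA"
    using res measurable_cong_sets[OF sets_round_law[OF D'] refl] by blast
  let ?E = "{x \<in> space (round_law D). \<not> (case x of (s, t) \<Rightarrow> result (post_cutoff A) s t) \<in> correct_sols QA D}"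
  have E: "?E \<in> sets (round_law D)"
    by measurable
  have "1 - \<delta> \<le> R.prob {(s, t) \<in> space (round_law D). result (post_cutoff A) s t \<in> correct_sols QA D}"
    using corr D by (simp add: delta_correct_def)
  also have "{(s, t) \<in> space (round_law D). result (post_cutoff A) s t \<in> correct_sols QA D} =
      {x \<in> space (round_law D). (case x of (s, t) \<Rightarrow> result (post_cutoff A) s t) \<in> correct_sols QA D}"
    by auto
  finally have bound: "emeasure (round_law D) ?E \<le> ennreal \<delta>"
    using R.prob_ge_iff_emeasure_neg_le[OF E] \<open>0 < \<delta>\<close> by simp
  have "(\<integral>\<^sup>+ w. indicator F w \<partial>run_law D) \<le> (\<integral>\<^sup>+ w. ennreal \<delta> \<partial>run_law D)"
  proof (rule resampling_nn_integral_le[OF resampling_run_law[OF D' order_refl]])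
    fix w :: "(nat \<Rightarrow> nat \<Rightarrow> 'x) \<times> (nat \<Rightarrow> 'r)"
    have "(\<integral>\<^sup>+ x. indicator F ((fst w)(N := fst x), (snd w)(N := snd x)) \<partial>round_law D) \<le>
        (\<integral>\<^sup>+ x. indicator ?E x \<partial>round_law D)"
      by (intro nn_integral_mono) (auto simp: F_def split: split_indicator)
    then show "(\<integral>\<^sup>+ x. indicator F ((fst w)(N := fst x), (snd w)(N := snd x)) \<partial>round_law D) \<le> ennreal \<delta>"
      using E bound by simp
  qed (use F in simp)
  then show "emeasure (run_law D) F \<le> ennreal \<delta>"
    using F by (simp add: M.emeasure_space_1)
qed

section \<open>Resources, correctness and replicability of the composition\<close>

lemma samples_before_expectation:
  assumes D: "D \<in> distributions_on (dom_space QA)"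
    and samp: "\<And>j. expected_samples_le iid_stream R (dom_space (Q j)) E (subroutine A j)"
  shows "(\<integral>\<^sup>+ w. ennreal_of_enat (samples_before A (fst w) (snd w) N) \<partial>run_law D) \<le> of_nat N * ennreal E"
proof -
  have "(\<integral>\<^sup>+ w. ennreal_of_enat (samples_before A (fst w) (snd w) N) \<partial>run_law D) =
      (\<Sum>i<N. \<integral>\<^sup>+ w. ennreal_of_enat (round_samples A (fst w) (snd w) i) \<partial>run_law D)"
    unfolding samples_before_def sum_ennreal_of_enat[symmetric]
    by (intro nn_integral_sum round_samples_measurable[OF D]) simp
  also have "\<dots> \<le> (\<Sum>i<N. ennreal E)"
  proof (rule sum_mono)
    fix i assume "i \<in> {..<N}"
    then have i: "i < N" by simp
    show "(\<integral>\<^sup>+ w. ennreal_of_enat (round_samples A (fst w) (snd w) i) \<partial>run_law D) \<le> ennreal E"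
    proof (rule nn_integral_round_le[OF D i _ round_samples_measurable[OF D i]])
      fix j
      have "(\<lambda>(s, t). samples (subroutine A j) s t)
          \<in> iid_stream (dom_space (Q j)) \<Otimes>\<^sub>M R \<rightarrow>\<^sub>M count_space UNIV"
        using subroutine_algorithm[of j] by (simp add: algorithm_def)
      from measurable_compose[OF this, of ennreal_of_enat borel]
      show "(\<lambda>(s, t). ennreal_of_enat (samples (subroutine A j) s t))
          \<in> borel_measurable (iid_stream (dom_space (Q j)) \<Otimes>\<^sub>M R)"
        by (simp add: split_beta)
      show "(\<integral>\<^sup>+ (s, t). ennreal_of_enat (samples (subroutine A j) s t) \<partial>sub_law j D) \<le> ennreal E"
        using samp[of j] sub_dist_distribution[OF D] by (simp add: expected_samples_le_def)
    qed (simp add: round_samples_def Let_def)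
  qed
  finally show ?thesis by simp
qed

text \<open>Markov's inequality at the threshold \<open>m + 1\<close>, kept as a product to avoid
  division in \<open>ennreal\<close>.\<close>

lemma cut_off_emeasure:
  assumes D: "D \<in> distributions_on (dom_space QA)"
    and samp: "\<And>j. expected_samples_le iid_stream R (dom_space (Q j)) E (subroutine A j)"
  shows "of_nat (Suc m) * emeasure (run_law D) {w \<in> space (run_law D). cut_off N m A (fst w) (snd w)}
    \<le> of_nat N * ennreal E"
proof -
  let ?C = "{w \<in> space (run_law D). cut_off N m A (fst w) (snd w)}"
  have "of_nat (Suc m) * emeasure (run_law D) ?C = (\<integral>\<^sup>+ w. of_nat (Suc m) * indicator ?C w \<partial>run_law D)"
    by (rule nn_integral_cmult_indicator[symmetric, OF cut_off_sets[OF D]])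
  also have "\<dots> \<le> (\<integral>\<^sup>+ w. ennreal_of_enat (samples_before A (fst w) (snd w) N) \<partial>run_law D)"
    by (intro nn_integral_mono) (auto simp: cut_off_iff split: split_indicator)
  also have "\<dots> \<le> of_nat N * ennreal E"
    by (rule samples_before_expectation[OF D samp])
  finally show ?thesis .
qed

lemma post_cutoff_worst_case_samples:
  assumes "worst_case_samples_le iid_stream R (dom_space QA) (real m) (post_cutoff A)"
    and "S \<in> space (iid_rounds N (dom_space QA))" "r \<in> space (round_strings N R)"
  shows "ennreal_of_enat (samples (post_cutoff A) (S N) (r N)) \<le> of_nat m"
  using assms(1) measurable_space[OF measurable_iid_rounds_component assms(2), of N]
    measurable_space[OF measurable_round_strings_component assms(3), of N]
  by (auto simp: worst_case_samples_le_def ennreal_of_nat_eq_real_of_nat)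

text \<open>A charging argument: in a cut-off run both the \<open>m\<close> samples already read and
  the at most \<open>m\<close> samples read afterwards are bounded by the samples that the
  untruncated run requests. Hence the factor \<open>2\<close>, independently of how likely the
  cutoff is.\<close>

lemma composed_expected_samples:
  assumes samp: "\<And>j. expected_samples_le iid_stream R (dom_space (Q j)) E (subroutine A j)"
    and "0 \<le> E"
    and post: "worst_case_samples_le iid_stream R (dom_space QA) (real m) (post_cutoff A)"
  shows "expected_samples_le (iid_rounds N) (round_strings N R) (dom_space QA) (2 * (real N * E))
    (composed_algo N m A)"
  unfolding expected_samples_le_def
proof
  fix D assume D: "D \<in> distributions_on (dom_space QA)"
  have space_eq: "space (iid_rounds N D) = space (iid_rounds N (dom_space QA))"
    by (intro sets_eq_imp_space_eq sets_iid_rounds_cong distributions_onD[OF D])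
  have "(\<integral>\<^sup>+ (S, r). ennreal_of_enat (samples (composed_algo N m A) S r) \<partial>run_law D) \<le>
      (\<integral>\<^sup>+ w. 2 * ennreal_of_enat (samples_before A (fst w) (snd w) N) \<partial>run_law D)"
  proof (intro nn_integral_mono, clarify)
    fix S r assume Sr: "(S, r) \<in> space (run_law D)"
    have "ennreal_of_enat (samples (post_cutoff A) (S N) (r N)) \<le> of_nat m"
      using Sr space_eq by (intro post_cutoff_worst_case_samples[OF post]) (auto simp: space_pair_measure)
    moreover have *: "of_nat m \<le> ennreal_of_enat (samples_before A S r N)" if "cut_off N m A S r"
      using that by (simp add: cut_off_def flip: ennreal_of_enat_enat)
    ultimately have "ennreal_of_enat (samples (post_cutoff A) (S N) (r N)) \<le>
        ennreal_of_enat (samples_before A S r N)" if "cut_off N m A S r"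
      using that by (meson order_trans)
    with * have "ennreal_of_enat (samples (composed_algo N m A) S r) \<le>
        ennreal_of_enat (samples_before A S r N) + ennreal_of_enat (samples_before A S r N)"
      by (auto simp: composed_algo_def intro!: add_mono)
    then show "ennreal_of_enat (samples (composed_algo N m A) S r) \<le>
        2 * ennreal_of_enat (samples_before A (fst (S, r)) (snd (S, r)) N)"
      by (simp add: mult_2)
  qed
  also have "\<dots> = 2 * (\<integral>\<^sup>+ w. ennreal_of_enat (samples_before A (fst w) (snd w) N) \<partial>run_law D)"
    by (rule nn_integral_cmult[OF samples_before_measurable[OF D]])
  also have "\<dots> \<le> 2 * (of_nat N * ennreal E)"
    by (intro mult_left_mono samples_before_expectation[OF D samp]) simp
  also have "\<dots> = ennreal (2 * (real N * E))"
    using \<open>0 \<le> E\<close> by (simp add: ennreal_mult' ennreal_of_nat_eq_real_of_nat)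
  finally show "(\<integral>\<^sup>+ (S, r). ennreal_of_enat (samples (composed_algo N m A) S r) \<partial>run_law D) \<le> \<dots>" .
qed

lemma composed_worst_case_samples:
  assumes post: "worst_case_samples_le iid_stream R (dom_space QA) (real m) (post_cutoff A)"
  shows "worst_case_samples_le (iid_rounds N) (round_strings N R) (dom_space QA) (2 * real m)
    (composed_algo N m A)"
  unfolding worst_case_samples_le_def
proof (intro ballI)
  fix S r assume Sr: "S \<in> space (iid_rounds N (dom_space QA))" "r \<in> space (round_strings N R)"
  have "ennreal_of_enat (samples_before A S r N) \<le> of_nat m" if "\<not> cut_off N m A S r"
    using that by (simp add: cut_off_def not_less flip: ennreal_of_enat_enat)
  with post_cutoff_worst_case_samples[OF post Sr]
  have "ennreal_of_enat (samples (composed_algo N m A) S r) \<le> of_nat m + of_nat m"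
    by (auto simp: composed_algo_def intro: add_increasing)
  also have "\<dots> = ennreal (2 * real m)"
    by (simp add: ennreal_of_nat_eq_real_of_nat flip: ennreal_plus)
  finally show "ennreal_of_enat (samples (composed_algo N m A) S r) \<le> ennreal (2 * real m)" .
qed

section \<open>Running time\<close>

lemma composed_runtime_le:
  "runtime (composed_algo N m A) S r \<le> (\<Sum>i<N. round_runtime A S r i) +
     (if cut_off N m A S r then runtime (post_cutoff A) (S N) (r N) else 0)"
  by (auto simp: composed_algo_def intro!: add_mono sum_mono2)

lemma composed_worst_case_runtime:
  assumes sub: "\<And>j. worst_case_runtime_le iid_stream R (dom_space (Q j)) V (subroutine A j)"
    and post: "worst_case_runtime_le iid_stream R (dom_space QA) (B * (real N * V)) (post_cutoff A)"
    and "0 \<le> B"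
  shows "worst_case_runtime_le (iid_rounds N) (round_strings N R) (dom_space QA)
    ((1 + B) * (real N * V)) (composed_algo N m A)"
  unfolding worst_case_runtime_le_def
proof (intro ballI)
  fix S r assume Sr: "S \<in> space (iid_rounds N (dom_space QA))" "r \<in> space (round_strings N R)"
  have comp: "S i \<in> space (iid_stream (dom_space QA))" "r i \<in> space R" if "i \<le> N" for i
    using measurable_space[OF measurable_iid_rounds_component[OF that] Sr(1)]
      measurable_space[OF measurable_round_strings_component[OF that] Sr(2)] by auto
  have "round_runtime A S r i \<le> ennreal V" if "i < N" for i
  proof -
    have "proj A j \<circ> S i \<in> space (iid_stream (dom_space (Q j)))" for j
      using comp(1)[of i] that measurable_space[OF proj_measurable]
      by (auto simp: iid_stream_def space_PiM PiE_iff)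
    then show ?thesis
      using sub comp(2)[of i] that by (simp add: worst_case_runtime_le_def round_runtime_def Let_def)
  qed
  then have "(\<Sum>i<N. round_runtime A S r i) \<le> (\<Sum>i<N. ennreal V)"
    by (intro sum_mono) simp
  moreover have "(if cut_off N m A S r then runtime (post_cutoff A) (S N) (r N) else 0) \<le>
      ennreal (B * (real N * V))"
    using post comp[of N] by (simp add: worst_case_runtime_le_def)
  ultimately have "runtime (composed_algo N m A) S r \<le> (\<Sum>i<N. ennreal V) + ennreal (B * (real N * V))"
    by (intro order_trans[OF composed_runtime_le] add_mono)
  also have "\<dots> = ennreal ((1 + B) * (real N * V))"
  proof -
    \<comment> \<open>\<open>ennreal_mult'\<close> asks for the sign of one factor only.
      \<open>V\<close> may be negative, in which case \<open>ennreal V\<close> is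
      \<open>0\<close>.\<close>
    have "ennreal ((1 + B) * (real N * V)) = (1 + ennreal B) * (of_nat N * ennreal V)"
      using \<open>0 \<le> B\<close> by (simp add: ennreal_mult' ennreal_of_nat_eq_real_of_nat)
    then show ?thesis
      using \<open>0 \<le> B\<close> by (simp add: ennreal_mult' ennreal_of_nat_eq_real_of_nat distrib_right)
  qed
  finally show "runtime (composed_algo N m A) S r \<le> ennreal ((1 + B) * (real N * V))" .
qed

text \<open>The cutoff is decided by the rounds below \<open>N\<close>, the post-cutoff cost by
  component \<open>N\<close>. Redrawing the latter bounds its contribution by the product of
  \<open>q\<close> and \<open>W\<close>.\<close>

lemma composed_expected_runtime:
  assumes sub: "\<And>j. expected_runtime_le iid_stream R (dom_space (Q j)) V (subroutine A j)"
    and post: "expected_runtime_le iid_stream R (dom_space QA) W (post_cutoff A)"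
    and cut: "\<And>D. D \<in> distributions_on (dom_space QA) \<Longrightarrow>
      emeasure (run_law D) {w \<in> space (run_law D). cut_off N m A (fst w) (snd w)} \<le> ennreal q"
    and D: "D \<in> distributions_on (dom_space QA)"
  shows "(\<integral>\<^sup>+ (S, r). runtime (composed_algo N m A) S r \<partial>run_law D) \<le>
    of_nat N * ennreal V + ennreal q * ennreal W"
proof -
  have post_meas: "(\<lambda>(s, t). runtime (post_cutoff A) s t) \<in> borel_measurable (round_law (dom_space QA))"
    using post_cutoff_algorithm by (simp add: algorithm_def)
  let ?C = "{w \<in> space (run_law D). cut_off N m A (fst w) (snd w)}"
  let ?p = "\<lambda>w. indicator ?C w * runtime (post_cutoff A) (fst w N) (snd w N)"
  note cut_off_sets[OF D, measurable] post_cutoff_measurable[OF D post_meas, measurable]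
    round_runtime_measurable[OF D, measurable]
  have p: "?p \<in> borel_measurable (run_law D)"
    by measurable
  have "(\<integral>\<^sup>+ (S, r). runtime (composed_algo N m A) S r \<partial>run_law D) \<le>
      (\<integral>\<^sup>+ w. (\<Sum>i<N. round_runtime A (fst w) (snd w) i) + ?p w \<partial>run_law D)"
  proof (rule nn_integral_mono, clarify)
    fix S r assume "(S, r) \<in> space (run_law D)"
    then show "runtime (composed_algo N m A) S r \<le>
        (\<Sum>i<N. round_runtime A (fst (S, r)) (snd (S, r)) i) + ?p (S, r)"
      using composed_runtime_le[of m S r] by (cases "cut_off N m A S r") simp_all
  qed
  also have "\<dots> = (\<integral>\<^sup>+ w. (\<Sum>i<N. round_runtime A (fst w) (snd w) i) \<partial>run_law D) + (\<integral>\<^sup>+ w. ?p w \<partial>run_law D)"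
    by (intro nn_integral_add p borel_measurable_sum round_runtime_measurable[OF D]) simp
  also have "(\<integral>\<^sup>+ w. (\<Sum>i<N. round_runtime A (fst w) (snd w) i) \<partial>run_law D) =
      (\<Sum>i<N. \<integral>\<^sup>+ w. round_runtime A (fst w) (snd w) i \<partial>run_law D)"
    by (intro nn_integral_sum round_runtime_measurable[OF D]) simp
  also have "\<dots> \<le> (\<Sum>i<N. ennreal V)"
  proof (rule sum_mono)
    fix i assume "i \<in> {..<N}"
    then have i: "i < N" by simp
    show "(\<integral>\<^sup>+ w. round_runtime A (fst w) (snd w) i \<partial>run_law D) \<le> ennreal V"
    proof (rule nn_integral_round_le[OF D i _ round_runtime_measurable[OF D i]])
      fix j
      show "(\<lambda>(s, t). runtime (subroutine A j) s t)
          \<in> borel_measurable (iid_stream (dom_space (Q j)) \<Otimes>\<^sub>M R)"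
        using subroutine_algorithm[of j] by (simp add: algorithm_def)
      show "(\<integral>\<^sup>+ (s, t). runtime (subroutine A j) s t \<partial>sub_law j D) \<le> ennreal V"
        using sub[of j] sub_dist_distribution[OF D] by (simp add: expected_runtime_le_def)
    qed (simp add: round_runtime_def Let_def)
  qed
  also have "(\<Sum>i<N. ennreal V) = of_nat N * ennreal V"
    by simp
  also have "(\<integral>\<^sup>+ w. ?p w \<partial>run_law D) \<le> (\<integral>\<^sup>+ w. indicator ?C w * ennreal W \<partial>run_law D)"
  proof (rule resampling_nn_integral_le[OF resampling_run_law[OF D order_refl] p])
    fix w :: "(nat \<Rightarrow> nat \<Rightarrow> 'x) \<times> (nat \<Rightarrow> 'r)"
    assume w: "w \<in> space (run_law D)"
    have post_meas': "(\<lambda>(s, t). runtime (post_cutoff A) s t) \<in> borel_measurable (round_law D)"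
      using post_meas measurable_cong_sets[OF sets_round_law[OF D] refl] by blast
    \<comment> \<open>The cutoff event ignores component \<open>N\<close>, so its indicator leaves
      the inner integral.\<close>
    have samples_upd: "samples_before A (S(N := s)) (r(N := t)) N = samples_before A S r N" for S r s t
      unfolding samples_before_def round_samples_def round_index_def Let_def
      by (intro sum.cong refl) (simp add: transcript_cong[where S = "S(N := s)" and r = "r(N := t)" and S' = S and r' = r])
    have "(\<integral>\<^sup>+ x. ?p ((fst w)(N := fst x), (snd w)(N := snd x)) \<partial>round_law D) \<le>
        (\<integral>\<^sup>+ x. indicator ?C w * (case x of (s, t) \<Rightarrow> runtime (post_cutoff A) s t) \<partial>round_law D)"
      using w by (intro nn_integral_mono)
        (auto simp: cut_off_def samples_upd split_beta split: split_indicator)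
    also have "\<dots> = indicator ?C w * (\<integral>\<^sup>+ (s, t). runtime (post_cutoff A) s t \<partial>round_law D)"
      by (rule nn_integral_cmult[OF post_meas'])
    also have "\<dots> \<le> indicator ?C w * ennreal W"
      using post D by (intro mult_left_mono) (auto simp: expected_runtime_le_def)
    finally show "(\<integral>\<^sup>+ x. ?p ((fst w)(N := fst x), (snd w)(N := snd x)) \<partial>round_law D) \<le>
        indicator ?C w * ennreal W" .
  qed
  also have "\<dots> = emeasure (run_law D) ?C * ennreal W"
    by (simp add: nn_integral_multc)
  also have "\<dots> \<le> ennreal q * ennreal W"
    by (intro mult_right_mono cut[OF D]) simp
  finally show ?thesis
    by (simp add: add_mono)
qed

section \<open>Correctness and replicability\<close>

lemma composed_result_measurable:
  assumes D: "D \<in> distributions_on (dom_space QA)"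
  shows "(\<lambda>w. result (composed_algo N m A) (fst w) (snd w)) \<in> run_law D \<rightarrow>\<^sub>M sol_space QA"
proof -
  have res: "(\<lambda>(s, t). result (post_cutoff A) s t) \<in> round_law (dom_space QA) \<rightarrow>\<^sub>M sol_space QA"
    using post_cutoff_algorithm by (simp add: algorithm_def)
  show ?thesis
    unfolding composed_algo_def algo.simps
    by (intro measurable_If post_cutoff_measurable[OF D res] aggregate_measurable[OF D] cut_off_sets[OF D])
qed

text \<open>Whichever branch is taken, a wrong result comes from a wrong aggregate of the full
  transcript or a wrong post-cutoff output: \<open>N * (\<delta> / 2) + \<delta> / 2\<close> in
  total.\<close>

lemma composed_correct:
  assumes con: "consistent N Q QA A" and "0 < \<delta>"
    and corr: "\<And>j. delta_correct iid_stream R (Q j) (\<delta> / 2) (subroutine A j)"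
    and post: "delta_correct iid_stream R QA (\<delta> / 2) (post_cutoff A)"
  shows "delta_correct (iid_rounds N) (round_strings N R) QA (real N * \<delta>) (composed_algo N m A)"
  unfolding delta_correct_def
proof
  fix D assume D: "D \<in> dists QA"
  have D': "D \<in> distributions_on (dom_space QA)"
    using composed_problem D by (auto simp: statistical_problem_def)
  interpret prob_space "run_law D" by (rule prob_spaces[OF D'])
  have C[measurable]: "correct_sols QA D \<in> sets (sol_space QA)"
    using composed_problem D by (simp add: statistical_problem_def)
  have pos: "0 < \<delta> / 2" using \<open>0 < \<delta>\<close> by simp
  let ?good = "\<lambda>w. result (composed_algo N m A) (fst w) (snd w) \<in> correct_sols QA D"
  let ?Fa = "{w \<in> space (run_law D). aggregate A (transcript A (fst w) (snd w) N) \<notin> correct_sols QA D}"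
  let ?Fp = "{w \<in> space (run_law D). result (post_cutoff A) (fst w N) (snd w N) \<notin> correct_sols QA D}"
  note Fa = aggregate_failure[OF D con pos corr]
  note Fp = post_cutoff_failure[OF D pos post]
  note composed_result_measurable[OF D', measurable]
  have F: "{w \<in> space (run_law D). \<not> ?good w} \<in> events"
    by measurable
  have "emeasure (run_law D) {w \<in> space (run_law D). \<not> ?good w} \<le> ennreal (real N * \<delta>)"
  \<comment> \<open>The additional \<open>\<delta> / 2\<close> fits below
    \<open>N * \<delta>\<close> only for \<open>N \<ge> 1\<close>. Without rounds there is no
    cutoff, so the error is that of the aggregate alone.\<close>
  proof (cases "N = 0")
    case True
    have "{w \<in> space (run_law D). \<not> ?good w} \<subseteq> ?Fa"
      using True by (auto simp: composed_algo_def cut_off_def samples_before_def)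
    then have "emeasure (run_law D) {w \<in> space (run_law D). \<not> ?good w} \<le> of_nat N * ennreal (\<delta> / 2)"
      using Fa by (meson emeasure_mono order_trans)
    then show ?thesis using True by simp
  next
    case False
    have "{w \<in> space (run_law D). \<not> ?good w} \<subseteq> ?Fa \<union> ?Fp"
      by (auto simp: composed_algo_def)
    then have "emeasure (run_law D) {w \<in> space (run_law D). \<not> ?good w} \<le> emeasure (run_law D) (?Fa \<union> ?Fp)"
      using Fa(1) Fp(1) by (intro emeasure_mono) auto
    also have "\<dots> \<le> emeasure (run_law D) ?Fa + emeasure (run_law D) ?Fp"
      by (rule emeasure_subadditive[OF Fa(1) Fp(1)])
    also have "\<dots> \<le> of_nat N * ennreal (\<delta> / 2) + ennreal (\<delta> / 2)"
      by (intro add_mono Fa Fp)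
    also have "\<dots> = ennreal (real N * (\<delta> / 2) + \<delta> / 2)"
      using pos by (simp add: ennreal_mult' ennreal_of_nat_eq_real_of_nat del: times_divide_eq_right)
    also have "\<dots> \<le> ennreal (real N * \<delta>)"
      using mult_right_mono[of 1 "real N" "\<delta> / 2"] False pos by (intro ennreal_leI) (simp add: field_simps)
    finally show ?thesis .
  qed
  then have "1 - real N * \<delta> \<le> prob {w \<in> space (run_law D). ?good w}"
    using \<open>0 < \<delta>\<close> by (subst prob_ge_iff_emeasure_neg_le[OF F]) auto
  also have "{w \<in> space (run_law D). ?good w} =
      {(S, r) \<in> space (run_law D). result (composed_algo N m A) S r \<in> correct_sols QA D}"
    by auto
  finally show "1 - real N * \<delta> \<le>
      prob {(S, r) \<in> space (run_law D). result (composed_algo N m A) S r \<in> correct_sols QA D}" .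
qed

text \<open>Three events of probability at most \<open>N * \<rho> / 3\<close> cover every
  disagreement: a cutoff of the first run, one of the second, and different aggregates. This is the
  origin of the fraction \<open>\<rho> / 3\<close>.\<close>

lemma composed_replicable:
  assumes "0 < \<rho>"
    and rep: "\<And>j. replicable iid_stream R (dom_space (Q j)) (\<rho> / 3) (subroutine A j)"
    and cut: "\<And>D. D \<in> distributions_on (dom_space QA) \<Longrightarrow>
      emeasure (run_law D) {w \<in> space (run_law D). cut_off N m A (fst w) (snd w)} \<le> ennreal (real N * \<rho> / 3)"
  shows "replicable (iid_rounds N) (round_strings N R) (dom_space QA) (real N * \<rho>) (composed_algo N m A)"
  unfolding replicable_def
proof
  fix D assume D: "D \<in> distributions_on (dom_space QA)"
  interpret prob_space "run_law2 D" by (rule prob_spaces[OF D])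
  note S = prob_space_iid_rounds[OF distributions_onD(1)[OF D], of N]
  note r = prob_space_round_strings[OF prob_R, of N]
  interpret S: prob_space "iid_rounds N D" by (rule S)
  \<comment> \<open>Each of the two runs, seen alone, has the law of a single run, so the bound
    \<open>cut\<close> applies to both.\<close>
  have marg1: "distr (run_law2 D) (run_law D) (\<lambda>w. (fst (snd w), fst w)) = run_law D"
    by (rule distr_pair_swap_marginal[OF r prob_space_pair[OF S S] measurable_fst S.distr_pair_fst])
  have "distr (iid_rounds N D \<Otimes>\<^sub>M iid_rounds N D) (iid_rounds N D) snd = iid_rounds N D"
  proof -
    interpret SS: pair_sigma_finite "iid_rounds N D" "iid_rounds N D" ..
    have "distr (iid_rounds N D \<Otimes>\<^sub>M iid_rounds N D) (iid_rounds N D) snd =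
        distr (distr (iid_rounds N D \<Otimes>\<^sub>M iid_rounds N D) (iid_rounds N D \<Otimes>\<^sub>M iid_rounds N D)
          (\<lambda>(x, y). (y, x))) (iid_rounds N D) fst"
      by (subst distr_distr) (auto simp: comp_def split_beta)
    also have "\<dots> = iid_rounds N D"
      by (simp add: SS.distr_pair_swap[symmetric] S.distr_pair_fst)
    finally show ?thesis .
  qed
  from distr_pair_swap_marginal[OF r prob_space_pair[OF S S] measurable_snd this]
  have marg2: "distr (run_law2 D) (run_law D) (\<lambda>w. (snd (snd w), fst w)) = run_law D" .
  have m1[measurable]: "(\<lambda>w. (fst (snd w), fst w)) \<in> run_law2 D \<rightarrow>\<^sub>M run_law D"
    and m2[measurable]: "(\<lambda>w. (snd (snd w), fst w)) \<in> run_law2 D \<rightarrow>\<^sub>M run_law D"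
    by measurable
  let ?C = "{w \<in> space (run_law D). cut_off N m A (fst w) (snd w)}"
  let ?C1 = "(\<lambda>w. (fst (snd w), fst w)) -` ?C \<inter> space (run_law2 D)"
  let ?C2 = "(\<lambda>w. (snd (snd w), fst w)) -` ?C \<inter> space (run_law2 D)"
  note C = cut_off_sets[OF D]
  have C1: "?C1 \<in> events" "emeasure (run_law2 D) ?C1 \<le> ennreal (real N * \<rho> / 3)"
    using measurable_sets[OF m1 C] cut[OF D] emeasure_distr[OF m1 C] by (simp_all add: marg1)
  have C2: "?C2 \<in> events" "emeasure (run_law2 D) ?C2 \<le> ennreal (real N * \<rho> / 3)"
    using measurable_sets[OF m2 C] cut[OF D] emeasure_distr[OF m2 C] by (simp_all add: marg2)
  have differ: "{w \<in> space (run_law2 D). f (fst (snd w), fst w) \<noteq> f (snd (snd w), fst w)} \<in> events"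
    if f: "f \<in> run_law D \<rightarrow>\<^sub>M sol_space QA" for f
  proof -
    let ?d = "{p \<in> space (sol_space QA \<Otimes>\<^sub>M sol_space QA). fst p = snd p}"
    let ?ff = "\<lambda>w. (f (fst (snd w), fst w), f (snd (snd w), fst w))"
    have ff: "?ff \<in> run_law2 D \<rightarrow>\<^sub>M sol_space QA \<Otimes>\<^sub>M sol_space QA"
      using measurable_Pair[OF measurable_compose[OF m1 f] measurable_compose[OF m2 f]] .
    have "?d \<in> sets (sol_space QA \<Otimes>\<^sub>M sol_space QA)"
      using composed_problem by (simp add: statistical_problem_def)
    from measurable_sets[OF ff this]
    have "space (run_law2 D) - ?ff -` ?d \<inter> space (run_law2 D) \<in> events"
      by auto
    also have "space (run_law2 D) - ?ff -` ?d \<inter> space (run_law2 D) =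
        {w \<in> space (run_law2 D). f (fst (snd w), fst w) \<noteq> f (snd (snd w), fst w)}"
      using measurable_space[OF ff] by auto
    finally show ?thesis .
  qed
  let ?F = "{w \<in> space (run_law2 D). aggregate A (transcript A (fst (snd w)) (fst w) N) \<noteq>
      aggregate A (transcript A (snd (snd w)) (fst w) N)}"
  have F: "?F \<in> events"
    using differ[OF aggregate_measurable[OF D]] by simp
  have "emeasure (run_law2 D) ?F \<le> of_nat N * ennreal (\<rho> / 3)"
    using \<open>0 < \<rho>\<close> by (intro aggregate_disagreement[OF D _ rep F]) auto
  then have F_le: "emeasure (run_law2 D) ?F \<le> ennreal (real N * \<rho> / 3)"
    using \<open>0 < \<rho>\<close> by (simp add: ennreal_mult' ennreal_of_nat_eq_real_of_nat flip: times_divide_eq_right)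
  let ?agree = "\<lambda>w. result (composed_algo N m A) (fst (snd w)) (fst w) =
      result (composed_algo N m A) (snd (snd w)) (fst w)"
  have E: "{w \<in> space (run_law2 D). \<not> ?agree w} \<in> events"
    using differ[OF composed_result_measurable[OF D]] by simp
  have "{w \<in> space (run_law2 D). \<not> ?agree w} \<subseteq> ?F \<union> (?C1 \<union> ?C2)"
    using measurable_space[OF m1] measurable_space[OF m2] by (auto simp: composed_algo_def)
  then have "emeasure (run_law2 D) {w \<in> space (run_law2 D). \<not> ?agree w} \<le>
      emeasure (run_law2 D) (?F \<union> (?C1 \<union> ?C2))"
    using F C1(1) C2(1) by (intro emeasure_mono sets.Un)
  also have "\<dots> \<le> emeasure (run_law2 D) ?F + (emeasure (run_law2 D) ?C1 + emeasure (run_law2 D) ?C2)"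
    by (intro order_trans[OF emeasure_subadditive] add_left_mono emeasure_subadditive sets.Un F C1 C2)
  also have "\<dots> \<le> ennreal (real N * \<rho> / 3) + (ennreal (real N * \<rho> / 3) + ennreal (real N * \<rho> / 3))"
    by (intro add_mono F_le C1 C2)
  also have "\<dots> = ennreal (real N * \<rho>)"
    using \<open>0 < \<rho>\<close> by (simp flip: ennreal_plus)
  finally have "1 - real N * \<rho> \<le> prob {w \<in> space (run_law2 D). ?agree w}"
    using \<open>0 < \<rho>\<close> by (subst prob_ge_iff_emeasure_neg_le[OF E]) auto
  also have "{w \<in> space (run_law2 D). ?agree w} = {(r, S, S') \<in> space (run_law2 D).
      result (composed_algo N m A) S r = result (composed_algo N m A) S' r}"
    by auto
  finally show "1 - real N * \<rho> \<le> prob {(r, S, S') \<in> space (run_law2 D).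
      result (composed_algo N m A) S r = result (composed_algo N m A) S' r}" .
qed

text \<open>For the cutoff probability \<open>p\<close>, Markov and the choice of \<open>m\<close>
  give \<open>E / q * p \<le> N * E\<close>; cancelling \<open>E > 0\<close> leaves
  \<open>p \<le> N * q\<close>.\<close>

lemma cut_off_emeasure_le:
  assumes D: "D \<in> distributions_on (dom_space QA)"
    and samp: "\<And>j. expected_samples_le iid_stream R (dom_space (Q j)) E (subroutine A j)"
    and "0 < E" "0 < q" "E / q \<le> real (Suc m)"
  shows "emeasure (run_law D) {w \<in> space (run_law D). cut_off N m A (fst w) (snd w)} \<le> ennreal (real N * q)"
proof -
  interpret prob_space "run_law D" by (rule prob_spaces[OF D])
  define p where "p = prob {w \<in> space (run_law D). cut_off N m A (fst w) (snd w)}"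
  have p: "0 \<le> p" "emeasure (run_law D) {w \<in> space (run_law D). cut_off N m A (fst w) (snd w)} = ennreal p"
    by (simp_all add: p_def emeasure_eq_measure)
  have "ennreal (real (Suc m) * p) \<le> ennreal (real N * E)"
    using cut_off_emeasure[OF D samp, of m]
    by (simp only: p ennreal_mult' ennreal_of_nat_eq_real_of_nat of_nat_0_le_iff)
  then have "real (Suc m) * p \<le> real N * E"
    using \<open>0 < E\<close> by (subst (asm) ennreal_le_iff) auto
  moreover have "E / q * p \<le> real (Suc m) * p"
    using assms(5) p(1) by (rule mult_right_mono)
  ultimately have "E / q * p \<le> real N * E"
    by (rule order_trans[rotated])
  then have "E * p \<le> E * (real N * q)"
    using \<open>0 < q\<close> by (simp add: field_simps)
  then show ?thesis
    using \<open>0 < E\<close> by (simp add: p(2) ennreal_leI)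
qed

end

section \<open>Choice of the constants\<close>

lemma expected_samples_le_mono:
  "\<lbrakk>expected_samples_le law R X b A; b \<le> b'\<rbrakk> \<Longrightarrow> expected_samples_le law R X b' A"
  unfolding expected_samples_le_def by (meson ennreal_leI order_trans)

lemma worst_case_samples_le_mono:
  "\<lbrakk>worst_case_samples_le law R X b A; b \<le> b'\<rbrakk> \<Longrightarrow> worst_case_samples_le law R X b' A"
  unfolding worst_case_samples_le_def by (meson ennreal_leI order_trans)

theorem lemma6p14:
  fixes c :: real
  assumes "c > 0"
  shows "\<exists>K>0. \<forall>C>0. \<forall>\<rho>. 0 < \<rho> \<and> \<rho> < 1 \<longrightarrow>
    (\<exists>m::nat. real m \<le> K * (C * ln (1 / \<rho>) powr c / \<rho>\<^sup>2) \<and>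
      (\<forall>(N::nat) (\<delta>::real) (V :: real \<Rightarrow> real) (R :: 'r measure)
         (Q :: 'j \<Rightarrow> ('z, 'y) problem) (QA :: ('x, 'w) problem)
         (A :: ('x, 'z, 'r, 'y, 'j, 'w) composition).
         0 < \<delta> \<and>
         adaptive_composition N R Q QA A \<and>
         consistent N Q QA A \<and>
         (\<forall>j. replicable iid_stream R (dom_space (Q j)) (\<rho> / 3) (subroutine A j) \<and>
              delta_correct iid_stream R (Q j) (\<delta> / 2) (subroutine A j) \<and>
              expected_samples_le iid_stream R (dom_space (Q j))
                (C * ln (1 / \<rho>) powr c / \<rho>) (subroutine A j)) \<and>
         worst_case_samples_le iid_stream R (dom_space QA) (real m) (post_cutoff A) \<and>
         delta_correct iid_stream R QA (\<delta> / 2) (post_cutoff A)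
       \<longrightarrow>
         expected_samples_le (iid_rounds N) (round_strings N R) (dom_space QA)
           (K * (C * (real N * ln (1 / \<rho>) powr c) / \<rho>)) (composed_algo N m A) \<and>
         worst_case_samples_le (iid_rounds N) (round_strings N R) (dom_space QA)
           (K * (C * ln (1 / \<rho>) powr c / \<rho>\<^sup>2)) (composed_algo N m A) \<and>
         (\<forall>B\<ge>0.
            ((\<forall>j. worst_case_runtime_le iid_stream R (dom_space (Q j)) (V \<rho>) (subroutine A j)) \<and>
             worst_case_runtime_le iid_stream R (dom_space QA) (B * (real N * V \<rho>)) (post_cutoff A)
             \<longrightarrow>
             worst_case_runtime_le (iid_rounds N) (round_strings N R) (dom_space QA)
               (K * (1 + B) * (real N * V \<rho>)) (composed_algo N m A)) \<and>
            ((\<forall>j. expected_runtime_le iid_stream R (dom_space (Q j)) (V \<rho>) (subroutine A j)) \<and>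
             expected_runtime_le iid_stream R (dom_space QA) (B * (V \<rho> / \<rho>)) (post_cutoff A)
             \<longrightarrow>
             expected_runtime_le (iid_rounds N) (round_strings N R) (dom_space QA)
               (K * (1 + B) * (real N * V \<rho>)) (composed_algo N m A))) \<and>
         delta_correct (iid_rounds N) (round_strings N R) QA (real N * \<delta>) (composed_algo N m A) \<and>
         replicable (iid_rounds N) (round_strings N R) (dom_space QA) (real N * \<rho>)
           (composed_algo N m A)))"
\<comment> \<open>The constant \<open>6\<close> comes from the worst-case samples: a cutoff of at
  most \<open>3 * (E / \<rho>)\<close>, spent once before and once after it is hit. The other bounds
  need less.\<close>
proof (intro exI[of _ "6 :: real"] conjI allI impI, goal_cases)
  case (2 C \<rho>)
  then have C: "0 < C" and \<rho>: "0 < \<rho>" "\<rho> < 1" by auto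
  define E where "E = C * ln (1 / \<rho>) powr c / \<rho>"
  \<comment> \<open>Strict because \<open>x powr c\<close> vanishes only at \<open>x = 0\<close>,
    and \<open>\<rho> < 1\<close> rules out \<open>ln (1 / \<rho>) = 0\<close>.\<close>
  have E: "0 < E"
    using C \<rho> by (simp add: E_def)
  have E': "C * ln (1 / \<rho>) powr c / \<rho>\<^sup>2 = E / \<rho>"
    by (simp add: E_def power2_eq_square)
  have E_N: "C * (real N * ln (1 / \<rho>) powr c) / \<rho> = real N * E" for N
    by (simp add: E_def)
  \<comment> \<open>Rounding down keeps \<open>m\<close> within its size bound even if
    \<open>3 * (E / \<rho>) < 1\<close>, where \<open>m = 0\<close>; \<open>m + 1\<close> is still
    large enough for Markov with \<open>q = \<rho> / 3\<close>.\<close>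
  define m where "m = nat \<lfloor>3 * (E / \<rho>)\<rfloor>"
  have m: "real m \<le> 3 * (E / \<rho>)" "E / (\<rho> / 3) \<le> real (Suc m)"
  proof -
    have "0 \<le> 3 * (E / \<rho>)" using E \<rho> by simp
    then have "real m = of_int \<lfloor>3 * (E / \<rho>)\<rfloor>"
      by (simp add: m_def)
    then have "real m \<le> 3 * (E / \<rho>)" "3 * (E / \<rho>) \<le> real m + 1"
      by linarith+
    then show "real m \<le> 3 * (E / \<rho>)" "E / (\<rho> / 3) \<le> real (Suc m)"
      by (simp_all add: mult.commute)
  qed
  show ?case
    unfolding E' E_N E_def[symmetric]
  proof (intro exI[of _ m] conjI allI impI; (elim conjE)?)
    show "real m \<le> 6 * (E / \<rho>)"
      using m(1) E \<rho> by simp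
  next
    fix N :: nat and \<delta> :: real and V :: "real \<Rightarrow> real" and R :: "'r measure"
      and Q :: "'j \<Rightarrow> ('z, 'y) problem" and QA :: "('x, 'w) problem"
      and A :: "('x, 'z, 'r, 'y, 'j, 'w) composition"
    assume \<delta>: "0 < \<delta>" and ad: "adaptive_composition N R Q QA A" and con: "consistent N Q QA A"
      and sub: "\<forall>j. replicable iid_stream R (dom_space (Q j)) (\<rho> / 3) (subroutine A j) \<and>
              delta_correct iid_stream R (Q j) (\<delta> / 2) (subroutine A j) \<and>
              expected_samples_le iid_stream R (dom_space (Q j)) E (subroutine A j)"
      and post: "worst_case_samples_le iid_stream R (dom_space QA) (real m) (post_cutoff A)"
        "delta_correct iid_stream R QA (\<delta> / 2) (post_cutoff A)"
    interpret adaptive N R Q QA A by standard (fact ad)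
    from sub have rep: "\<And>j. replicable iid_stream R (dom_space (Q j)) (\<rho> / 3) (subroutine A j)"
      and corr: "\<And>j. delta_correct iid_stream R (Q j) (\<delta> / 2) (subroutine A j)"
      and samp: "\<And>j. expected_samples_le iid_stream R (dom_space (Q j)) E (subroutine A j)"
      by auto
    have cut: "emeasure (run_law D) {w \<in> space (run_law D). cut_off N m A (fst w) (snd w)} \<le>
        ennreal (real N * \<rho> / 3)" if "D \<in> distributions_on (dom_space QA)" for D
      using cut_off_emeasure_le[OF that samp E _ m(2)] \<rho> by simp
    show "expected_samples_le (iid_rounds N) (round_strings N R) (dom_space QA)
        (6 * (real N * E)) (composed_algo N m A)"
      using composed_expected_samples[OF samp less_imp_le[OF E] post(1)] E
      by (elim expected_samples_le_mono) simp
    show "worst_case_samples_le (iid_rounds N) (round_strings N R) (dom_space QA)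
        (6 * (E / \<rho>)) (composed_algo N m A)"
      using composed_worst_case_samples[OF post(1)] m(1)
      by (elim worst_case_samples_le_mono) simp
    show "delta_correct (iid_rounds N) (round_strings N R) QA (real N * \<delta>) (composed_algo N m A)"
      by (rule composed_correct[OF con \<delta> corr post(2)])
    show "replicable (iid_rounds N) (round_strings N R) (dom_space QA) (real N * \<rho>) (composed_algo N m A)"
      by (rule composed_replicable[OF \<rho>(1) rep cut])
    fix B :: real assume B: "0 \<le> B"
    show "worst_case_runtime_le (iid_rounds N) (round_strings N R) (dom_space QA)
        (6 * (1 + B) * (real N * V \<rho>)) (composed_algo N m A)"
      if "\<forall>j. worst_case_runtime_le iid_stream R (dom_space (Q j)) (V \<rho>) (subroutine A j)"
        "worst_case_runtime_le iid_stream R (dom_space QA) (B * (real N * V \<rho>)) (post_cutoff A)"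
    proof -
      have "ennreal ((1 + B) * (real N * V \<rho>)) \<le> 6 * ennreal ((1 + B) * (real N * V \<rho>))"
        using mult_right_mono[of 1 "6 :: ennreal"] by simp
      also have "\<dots> = ennreal (6 * (1 + B) * (real N * V \<rho>))"
        by (simp only: mult.assoc ennreal_mult'[of 6, OF zero_le_numeral] ennreal_numeral)
      finally show ?thesis
        using composed_worst_case_runtime[of "V \<rho>" B m] that B
        unfolding worst_case_runtime_le_def by (meson order_trans)
    qed
    show "expected_runtime_le (iid_rounds N) (round_strings N R) (dom_space QA)
        (6 * (1 + B) * (real N * V \<rho>)) (composed_algo N m A)"
      if "\<forall>j. expected_runtime_le iid_stream R (dom_space (Q j)) (V \<rho>) (subroutine A j)"
        "expected_runtime_le iid_stream R (dom_space QA) (B * (V \<rho> / \<rho>)) (post_cutoff A)"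
      unfolding expected_runtime_le_def
    proof
      fix D assume D: "D \<in> distributions_on (dom_space QA)"
      have "(\<integral>\<^sup>+ (S, r). runtime (composed_algo N m A) S r \<partial>run_law D) \<le>
          of_nat N * ennreal (V \<rho>) + ennreal (real N * \<rho> / 3) * ennreal (B * (V \<rho> / \<rho>))"
        using that by (intro composed_expected_runtime cut D) auto
      \<comment> \<open>Here \<open>\<rho>\<close> cancels: the post-cutoff procedure may cost
        \<open>1 / \<rho>\<close> times as much as a sub-routine, but it runs with probability at
        most \<open>N * \<rho> / 3\<close>. The factor \<open>ennreal (V \<rho>)\<close> is kept
        apart because the sign of \<open>V \<rho>\<close> is unknown.\<close>
      also have "\<dots> = ennreal (real N + real N * \<rho> / 3 * (B / \<rho>)) * ennreal (V \<rho>)"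
      proof -
        have nonneg: "0 \<le> real N * \<rho> / 3" "0 \<le> B / \<rho>"
          using \<rho> B by simp_all
        have "B * (V \<rho> / \<rho>) = B / \<rho> * V \<rho>"
          by simp
        then have "ennreal (B * (V \<rho> / \<rho>)) = ennreal (B / \<rho>) * ennreal (V \<rho>)"
          using ennreal_mult'[OF nonneg(2)] by simp
        moreover have "ennreal (real N + real N * \<rho> / 3 * (B / \<rho>)) =
            of_nat N + ennreal (real N * \<rho> / 3) * ennreal (B / \<rho>)"
          using nonneg by (simp only: ennreal_plus ennreal_mult' mult_nonneg_nonneg
              of_nat_0_le_iff ennreal_of_nat_eq_real_of_nat)
        ultimately show ?thesis
          by (simp only: distrib_right mult.assoc)
      qed
      also have "\<dots> \<le> ennreal (6 * (1 + B) * real N) * ennreal (V \<rho>)"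
      proof (intro mult_right_mono ennreal_leI)
        show "real N + real N * \<rho> / 3 * (B / \<rho>) \<le> 6 * (1 + B) * real N"
          using \<rho> B by (simp add: field_simps)
      qed simp
      also have "\<dots> = ennreal (6 * (1 + B) * (real N * V \<rho>))"
        using B by (subst ennreal_mult'[symmetric]) (simp_all add: mult.assoc)
      finally show "(\<integral>\<^sup>+ (S, r). runtime (composed_algo N m A) S r \<partial>run_law D) \<le>
          ennreal (6 * (1 + B) * (real N * V \<rho>))" .
    qed
  qed
qed simp

end
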